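(* Let $\mathcal{T}=(\mathcal{V},\mathcal{E})$ obey the LC-PF model and covariance assumption of the context, with $\Omega_p(c,c)+\Omega_q(c,c)>0$ for every non-root node $c$. Let $\mathcal{M}$ be a set of missing non-root nodes such that every missing node has degree greater than $2$ and any two missing nodes are at distance greater than two (in hops) in $\mathcal{T}$. Let $\mathcal{O}=\mathcal{V}\setminus\mathcal{M}$, and let $\mathcal{T}_{\mathcal{M}}$ be the minimum weight spanning tree of the complete graph on $\mathcal{O}$ with edge weights $\phi$. Let $b\in\mathcal{M}$ have (observed) parent $a$ and (observed) set of children $\mathcal{C}_b$. Let $c^*\in\arg\min_{c_i\in\mathcal{C}_b}\phi_{bc_i}$. Then: (i) no edge $(c_ic_j)$ with $c_i,c_j\in\mathcal{C}_b\setminus\{c^*\}$ exists in $\mathcal{T}_{\mathcal{M}}$; (ii) with $\mathcal{C}_b^1=\{c_i\in\mathcal{C}_b:\phi_{ac_i}<\phi_{c^*c_i}\}$, each node of $\mathcal{C}_b^1$ is connected to $a$ in $\mathcal{T}_{\mathcal{M}}$, and each node of $\mathcal{C}_b\setminus(\mathcal{C}_b^1\cup\{c^*\})$ is connected to $c^*$ in $\mathcal{T}_{\mathcal{M}}$.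
   Context: $\mathcal{T}=(\mathcal{V},\mathcal{E})$ is a tree with a distinguished root (substation) of degree one. Each edge $(ab)$ has resistance $r_{ab}>0$ and reactance $x_{ab}>0$. For a node $a$, $\mathcal{P}^a$ is the set of edges on the path from $a$ to the root. If $\mathcal{P}^b\subseteq\mathcal{P}^a$ and $(ab)\in\mathcal{E}$, then $b$ is the parent of $a$ and $a$ is a child of $b$. Let $H_{1/r},H_{1/x}$ be the weighted Laplacians with edge weights $1/r_{ab}$, $1/x_{ab}$, with the root row and column removed. Non-root nodes have random injections $p_a,q_a$. The LC-PF model gives $v=H_{1/r}^{-1}p+H_{1/x}^{-1}q$ and $\theta=H_{1/x}^{-1}p-H_{1/r}^{-1}q$; the root voltage is constant. Covariance assumption: $\Omega_p,\Omega_q$ are the covariances of $p,q$, and $\Omega_{pq}=\mathbb{E}[(p-\mathbb{E}p)(q-\mathbb{E}q)^T]=\Omega_{qp}^T$. For distinct non-root $a,b$, $\Omega_p(a,b)=\Omega_q(a,b)=\Omega_{qp}(a,b)=0$, and $\Omega_{qp}(a,a)\ge0$. Define $\phi_{ab}=\mathbb{E}[((v_a-\mathbb{E}v_a)-(v_b-\mathbb{E}v_b))^2]$. *)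

theory Defs
  imports "HOL-Probability.Probability"
begin

definition edges_on :: "'v set \<Rightarrow> 'v set set \<Rightarrow> bool" where
  "edges_on V E \<longleftrightarrow> (\<forall>e\<in>E. \<exists>u w. u \<in> V \<and> w \<in> V \<and> u \<noteq> w \<and> e = {u, w})"

definition walk :: "'v set set \<Rightarrow> 'v list \<Rightarrow> bool" where
  "walk E xs \<longleftrightarrow> xs \<noteq> [] \<and> (\<forall>i. Suc i < length xs \<longrightarrow> {xs ! i, xs ! Suc i} \<in> E)"

definition simple_path :: "'v set set \<Rightarrow> 'v \<Rightarrow> 'v \<Rightarrow> 'v list \<Rightarrow> bool" where
  "simple_path E u w xs \<longleftrightarrow> walk E xs \<and> distinct xs \<and> hd xs = u \<and> last xs = w"

definition graph_connected :: "'v set \<Rightarrow> 'v set set \<Rightarrow> bool" where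
  "graph_connected V E \<longleftrightarrow>
     (\<forall>u\<in>V. \<forall>w\<in>V. \<exists>xs. walk E xs \<and> hd xs = u \<and> last xs = w)"

definition is_cycle :: "'v set set \<Rightarrow> 'v list \<Rightarrow> bool" where
  "is_cycle E xs \<longleftrightarrow> 3 \<le> length xs \<and> distinct xs \<and> walk E xs \<and> {last xs, hd xs} \<in> E"

definition is_tree :: "'v set \<Rightarrow> 'v set set \<Rightarrow> bool" where
  "is_tree V E \<longleftrightarrow> finite V \<and> V \<noteq> {} \<and> edges_on V E \<and> graph_connected V E
                    \<and> \<not> (\<exists>xs. is_cycle E xs)"

definition degree :: "'v set set \<Rightarrow> 'v \<Rightarrow> nat" where
  "degree E u = card {w. {u, w} \<in> E}"

definition hop_dist :: "'v set set \<Rightarrow> 'v \<Rightarrow> 'v \<Rightarrow> nat" where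
  "hop_dist E u w = (LEAST n. \<exists>xs. walk E xs \<and> hd xs = u \<and> last xs = w \<and> length xs = Suc n)"

definition path_edges :: "'v set set \<Rightarrow> 'v \<Rightarrow> 'v \<Rightarrow> 'v set set" where
  "path_edges E rt a =
     (let xs = (THE xs. simple_path E a rt xs)
      in {{xs ! i, xs ! Suc i} | i. Suc i < length xs})"

definition parent_of :: "'v set set \<Rightarrow> 'v \<Rightarrow> 'v \<Rightarrow> 'v \<Rightarrow> bool" where
  "parent_of E rt b a \<longleftrightarrow> {a, b} \<in> E \<and> path_edges E rt b \<subseteq> path_edges E rt a"

definition children :: "'v set set \<Rightarrow> 'v \<Rightarrow> 'v \<Rightarrow> 'v set" where
  "children E rt b = {c. parent_of E rt b c}"

text \<open>Entries of the weighted Laplacian (edge weights \<open>w\<close>); it is only used on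
  non-rt indices, which realises the removal of the root row and column.\<close>
definition laplacian :: "'v set set \<Rightarrow> ('v set \<Rightarrow> real) \<Rightarrow> 'v \<Rightarrow> 'v \<Rightarrow> real" where
  "laplacian E w a c =
     (if a = c then (\<Sum>e\<in>{e\<in>E. a \<in> e}. w e)
      else if {a, c} \<in> E then - w {a, c} else 0)"

definition is_inverse_on :: "'v set \<Rightarrow> ('v \<Rightarrow> 'v \<Rightarrow> real) \<Rightarrow> ('v \<Rightarrow> 'v \<Rightarrow> real) \<Rightarrow> bool" where
  "is_inverse_on S H G \<longleftrightarrow>
     (\<forall>a\<in>S. \<forall>b\<in>S. (\<Sum>c\<in>S. H a c * G c b) = (if a = b then 1 else 0)) \<and>
     (\<forall>a\<in>S. \<forall>b\<in>S. (\<Sum>c\<in>S. G a c * H c b) = (if a = b then 1 else 0))"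

definition covar :: "'m measure \<Rightarrow> ('m \<Rightarrow> real) \<Rightarrow> ('m \<Rightarrow> real) \<Rightarrow> real" where
  "covar M X Y = integral\<^sup>L M (\<lambda>\<omega>. (X \<omega> - integral\<^sup>L M X) * (Y \<omega> - integral\<^sup>L M Y))"

definition phi :: "'m measure \<Rightarrow> ('v \<Rightarrow> 'm \<Rightarrow> real) \<Rightarrow> 'v \<Rightarrow> 'v \<Rightarrow> real" where
  "phi M v a b = integral\<^sup>L M (\<lambda>\<omega>. ((v a \<omega> - integral\<^sup>L M (v a)) - (v b \<omega> - integral\<^sup>L M (v b)))\<^sup>2)"

definition complete_edges :: "'v set \<Rightarrow> 'v set set" where
  "complete_edges W = {{u, w} | u w. u \<in> W \<and> w \<in> W \<and> u \<noteq> w}"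

text \<open>Weight of an edge set, with edge \<open>{u,w}\<close> weighing \<open>f u w\<close> (\<open>f\<close> symmetric);
  each edge is counted via its two orientations, hence the factor 1/2.\<close>
definition tree_weight :: "('v \<Rightarrow> 'v \<Rightarrow> real) \<Rightarrow> 'v set set \<Rightarrow> real" where
  "tree_weight f T = (\<Sum>(u, w)\<in>{(u, w). {u, w} \<in> T \<and> u \<noteq> w}. f u w) / 2"

definition is_spanning_tree_of_complete :: "'v set \<Rightarrow> 'v set set \<Rightarrow> bool" where
  "is_spanning_tree_of_complete W T \<longleftrightarrow> T \<subseteq> complete_edges W \<and> is_tree W T"

definition is_MST :: "'v set \<Rightarrow> ('v \<Rightarrow> 'v \<Rightarrow> real) \<Rightarrow> 'v set set \<Rightarrow> bool" where
  "is_MST W f T \<longleftrightarrow> is_spanning_tree_of_complete W T \<and>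
     (\<forall>T'. is_spanning_tree_of_complete W T' \<longrightarrow> tree_weight f T \<le> tree_weight f T')"

end

theory Submission
  imports Defs
begin

text \<open>
  Removing an edge \<open>e\<close> of the tree cuts off a branch below it, and these branches form a laminar
  family. Summing the Laplacian rows over a branch shows that the potential drop across \<open>e\<close> caused
  by an injection at \<open>d\<close> is the resistance of \<open>e\<close> if \<open>d\<close> lies in the branch, and 0 otherwise. Hence
  \<open>\<phi>\<^sub>u\<^sub>w\<close> is a sum over \<open>d\<close> of quadratic forms in the length of those edges between \<open>u\<close> and \<open>w\<close> that lie
  above \<open>d\<close>; it grows when more edges separate \<open>u\<close> from \<open>w\<close>, and it is additive through the common
  parent of two siblings. Claim (i) is then the cycle property of the minimum spanning tree for the
  triangle \<open>c\<^sub>i, c\<^sub>j, c\<^sup>*\<close>. Claim (ii) is the cut property for the observed part of the branch below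
  \<open>c\<^sub>i\<close>: since \<open>b\<close> is missing, every edge leaving it bridges at least the path from \<open>c\<^sub>i\<close> to \<open>a\<close> or to
  another child of \<open>b\<close>.

  Trees are handled through cuts: a graph is connected iff every proper vertex set is crossed by an
  edge, and acyclic iff every edge is the only one crossing some vertex set. Crossing is additive
  under symmetric difference of vertex sets, which makes edge exchange a matter of Boolean algebra.
\<close>

section \<open>Trees and minimum spanning trees through cuts\<close>

definition crosses :: "'v set \<Rightarrow> 'v set \<Rightarrow> bool" where
  "crosses X e \<longleftrightarrow> e \<inter> X \<noteq> {} \<and> \<not> e \<subseteq> X"

lemma crosses_pair [simp]: "crosses X {u, w} \<longleftrightarrow> (u \<in> X) \<noteq> (w \<in> X)"
  by (auto simp: crosses_def)

section \<open>Walks, their edges and the sets they cross\<close>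

definition list_edges :: "'v list \<Rightarrow> 'v set set" where
  "list_edges xs = {{xs ! i, xs ! Suc i} | i. Suc i < length xs}"

lemma list_edges_simps [simp]:
  "list_edges [] = {}"
  "list_edges [x] = {}"
  "list_edges (x # y # xs) = insert {x, y} (list_edges (y # xs))"
proof -
  show "list_edges (x # y # xs) = insert {x, y} (list_edges (y # xs))" (is "?L = ?R")
  proof
    show "?L \<subseteq> ?R"
    proof
      fix e assume "e \<in> ?L"
      then obtain i where "Suc i < length (x # y # xs)"
        "e = {(x # y # xs) ! i, (x # y # xs) ! Suc i}"
        unfolding list_edges_def by blast
      then show "e \<in> ?R"
        by (cases i) (auto simp: list_edges_def)
    qed
    show "?R \<subseteq> ?L"
    proof
      fix e assume "e \<in> ?R"
      then consider "e = {x, y}"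
        | i where "Suc i < length (y # xs)" "e = {(y # xs) ! i, (y # xs) ! Suc i}"
        unfolding list_edges_def by blast
      then show "e \<in> ?L"
      proof cases
        case 1
        then show ?thesis unfolding list_edges_def by (auto intro!: exI[of _ 0])
      next
        case 2
        then show ?thesis unfolding list_edges_def by (auto intro!: exI[of _ "Suc i"])
      qed
    qed
  qed
qed (auto simp: list_edges_def)

lemma walk_iff: "walk E xs \<longleftrightarrow> xs \<noteq> [] \<and> list_edges xs \<subseteq> E"
  unfolding walk_def list_edges_def by blast

lemma list_edges_subset: "e \<in> list_edges xs \<Longrightarrow> e \<subseteq> set xs"
  by (induction xs rule: induct_list012) auto

lemma list_edges_append_subset: "list_edges ys \<subseteq> list_edges (xs @ ys)"
proof (induction xs)
  case (Cons x xs)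
  then show ?case by (cases "xs @ ys") auto
qed simp

lemma list_edges_snoc: "xs \<noteq> [] \<Longrightarrow> list_edges (xs @ [z]) = insert {last xs, z} (list_edges xs)"
  by (induction xs rule: induct_list012) auto

text \<open>Membership in \<open>X\<close> can change only along an edge that crosses
  \<open>X\<close>. This is the link between walks and cuts.\<close>

lemma hd_last_not_crossing:
  assumes "xs \<noteq> []" "\<forall>e\<in>list_edges xs. \<not> crosses X e"
  shows "hd xs \<in> X \<longleftrightarrow> last xs \<in> X"
  using assms by (induction xs rule: induct_list012) auto

text \<open>The first vertex is put in front of a simple path for the tail; if it already occurs
  there, the path is instead cut down to start at that occurrence.\<close>

lemma walk_imp_simple_path:
  assumes "walk E xs"
  shows "\<exists>ys. simple_path E (hd xs) (last xs) ys"
  using assms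
proof (induction xs rule: induct_list012)
  case (2 x)
  then show ?case by (auto simp: simple_path_def intro!: exI[of _ "[x]"])
next
  case (3 x y zs)
  then obtain ys where ys: "simple_path E y (last (y # zs)) ys"
    by (auto simp: walk_iff)
  show ?case
  proof (cases "x \<in> set ys")
    case True
    then obtain l r where "ys = l @ x # r" by (meson split_list)
    then have "simple_path E x (last (y # zs)) (x # r)"
      using ys list_edges_append_subset[of "x # r" l]
      by (auto simp: simple_path_def walk_iff)
    then show ?thesis by auto
  next
    case False
    then have "simple_path E x (last (y # zs)) (x # ys)"
      using ys 3 by (cases ys) (auto simp: simple_path_def walk_iff)
    then show ?thesis by auto
  qed
qed (simp add: walk_iff)

section \<open>Connectedness and acyclicity in terms of cuts\<close>

definition cut_connected :: "'v set \<Rightarrow> 'v set set \<Rightarrow> bool" where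
  "cut_connected V E \<longleftrightarrow> (\<forall>X. X \<subseteq> V \<and> X \<noteq> {} \<and> X \<noteq> V \<longrightarrow> (\<exists>e\<in>E. crosses X e))"

text \<open>For an edge \<open>e\<close> of a tree, \<open>X\<close> is one side of the fundamental
  cut of \<open>e\<close>.\<close>

definition sole_crossing :: "'v set set \<Rightarrow> 'v set \<Rightarrow> 'v set \<Rightarrow> bool" where
  "sole_crossing E X e \<longleftrightarrow> crosses X e \<and> (\<forall>f\<in>E - {e}. \<not> crosses X f)"

lemma sole_crossingD: "sole_crossing E X e \<Longrightarrow> f \<in> E \<Longrightarrow> f \<noteq> e \<Longrightarrow> \<not> crosses X f"
  by (simp add: sole_crossing_def)

definition all_bridges :: "'v set \<Rightarrow> 'v set set \<Rightarrow> bool" where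
  "all_bridges V E \<longleftrightarrow> (\<forall>e\<in>E. \<exists>X\<subseteq>V. sole_crossing E X e)"

lemma edges_on_obtain:
  assumes "edges_on V E" "e \<in> E"
  obtains u w where "u \<in> V" "w \<in> V" "u \<noteq> w" "e = {u, w}"
  using assms unfolding edges_on_def by blast

lemma edges_on_subset: "edges_on V E \<Longrightarrow> F \<subseteq> E \<Longrightarrow> edges_on V F"
  unfolding edges_on_def by (simp add: subset_iff)

lemma edges_on_insert:
  assumes "edges_on V E" "u \<in> V" "w \<in> V" "u \<noteq> w"
  shows "edges_on V (insert {u, w} E)"
  using assms unfolding edges_on_def by (simp, metis)

definition reach :: "'v set set \<Rightarrow> 'v \<Rightarrow> 'v set" where
  "reach E u = {w. \<exists>xs. walk E xs \<and> hd xs = u \<and> last xs = w}"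

lemma reach_refl: "u \<in> reach E u"
  unfolding reach_def by (auto intro!: exI[of _ "[u]"] simp: walk_iff)

lemma reach_step:
  assumes "w \<in> reach E u" "{w, z} \<in> E"
  shows "z \<in> reach E u"
proof -
  from assms(1) obtain xs where "walk E xs" "hd xs = u" "last xs = w"
    unfolding reach_def by blast
  then have "walk E (xs @ [z])" "hd (xs @ [z]) = u" "last (xs @ [z]) = z"
    using assms(2) by (auto simp: walk_iff list_edges_snoc)
  then show ?thesis unfolding reach_def by blast
qed

lemma reach_subset:
  assumes "edges_on V E" "u \<in> V"
  shows "reach E u \<subseteq> V"
proof
  fix w assume "w \<in> reach E u"
  then obtain xs where xs: "walk E xs" "hd xs = u" "last xs = w"
    unfolding reach_def by blast
  have "\<not> crosses V e" if "e \<in> E" for e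
    using assms(1) that unfolding crosses_def edges_on_def by auto
  then show "w \<in> V"
    using hd_last_not_crossing[of xs V] xs assms(2) by (auto simp: walk_iff)
qed

lemma reach_not_crossed:
  assumes "edges_on V E" "e \<in> E"
  shows "\<not> crosses (reach E u) e"
proof -
  obtain s t where "e = {s, t}" by (rule edges_on_obtain[OF assms])
  then show ?thesis
    using assms(2) reach_step[of s E u t] reach_step[of t E u s] by (auto simp: insert_commute)
qed

lemma cut_connectedD:
  assumes "cut_connected V E" "X \<subseteq> V" "\<And>e. e \<in> E \<Longrightarrow> \<not> crosses X e"
  shows "X = {} \<or> X = V"
  using assms unfolding cut_connected_def by blast

text \<open>A walk from inside \<open>X\<close> to outside must cross \<open>X\<close>; conversely,
  the set reachable from \<open>u\<close> is crossed by no edge and therefore is all of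
  \<open>V\<close>.\<close>

lemma graph_connected_iff_cut_connected:
  assumes "edges_on V E"
  shows "graph_connected V E \<longleftrightarrow> cut_connected V E"
proof
  assume L: "graph_connected V E"
  show "cut_connected V E"
    unfolding cut_connected_def
  proof (intro allI impI, rule ccontr)
    fix X assume X: "X \<subseteq> V \<and> X \<noteq> {} \<and> X \<noteq> V" and no: "\<not> (\<exists>e\<in>E. crosses X e)"
    then obtain u w where uw: "u \<in> X" "w \<in> V" "w \<notin> X" by blast
    then obtain xs where "walk E xs" "hd xs = u" "last xs = w"
      using L X unfolding graph_connected_def by blast
    then show False
      using hd_last_not_crossing[of xs X] no uw by (auto simp: walk_iff)
  qed
next
  assume R: "cut_connected V E"
  show "graph_connected V E"
    unfolding graph_connected_def
  proof (intro ballI)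
    fix u w assume "u \<in> V" "w \<in> V"
    have "reach E u = {} \<or> reach E u = V"
      by (rule cut_connectedD[OF R reach_subset[OF assms \<open>u \<in> V\<close>] reach_not_crossed[OF assms]])
    then have "reach E u = V" using reach_refl[of u E] by auto
    then show "\<exists>xs. walk E xs \<and> hd xs = u \<and> last xs = w"
      using \<open>w \<in> V\<close> unfolding reach_def by blast
  qed
qed

text \<open>The witness for \<open>{u, w}\<close> is the component of \<open>u\<close> after that
  edge is deleted. If it contained \<open>w\<close>, a simple path from \<open>u\<close> to
  \<open>w\<close> would be closed to a cycle by the edge.\<close>

lemma acyclic_imp_all_bridges:
  assumes E: "edges_on V E" and acyc: "\<not> (\<exists>xs. is_cycle E xs)"
  shows "all_bridges V E"
  unfolding all_bridges_def
proof
  fix e assume e: "e \<in> E"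
  obtain u w where uw: "u \<in> V" "w \<in> V" "u \<noteq> w" "e = {u, w}"
    by (rule edges_on_obtain[OF E e])
  have E': "edges_on V (E - {e})" using edges_on_subset[OF E] by simp
  let ?X = "reach (E - {e}) u"
  have "w \<notin> ?X"
  proof
    assume "w \<in> ?X"
    then obtain xs where xs: "simple_path (E - {e}) u w xs"
      unfolding reach_def using walk_imp_simple_path by blast
    have "is_cycle E xs"
    proof -
      \<comment> \<open>The short lists are impossible: \<open>[u]\<close> would give
        \<open>u = w\<close>, and \<open>[u, z]\<close> would use the deleted edge.\<close>
      consider "xs = []" | "xs = [u]" | z where "xs = [u, z]" | z y zs where "xs = u # z # y # zs"
        using xs by (metis list.sel(1) list.exhaust simple_path_def)
      then have "3 \<le> length xs"
        using xs uw by cases (auto simp: simple_path_def walk_iff)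
      then show ?thesis
        using xs uw e by (auto simp: is_cycle_def simple_path_def walk_iff insert_commute)
    qed
    then show False using acyc by blast
  qed
  then have "sole_crossing E ?X e"
    using reach_refl[of u "E - {e}"] uw reach_not_crossed[OF E']
    by (auto simp: sole_crossing_def)
  then show "\<exists>X\<subseteq>V. sole_crossing E X e"
    using reach_subset[OF E' \<open>u \<in> V\<close>] by blast
qed

text \<open>The rest of a cycle joins the ends of its closing edge without using it, so it would
  have to cross any set that the closing edge alone crosses.\<close>

lemma all_bridges_imp_acyclic:
  assumes "all_bridges V E"
  shows "\<not> is_cycle E xs"
proof
  assume cyc: "is_cycle E xs"
  let ?e = "{last xs, hd xs}"
  obtain X where X: "crosses X ?e" "\<forall>f\<in>E - {?e}. \<not> crosses X f"
    using assms cyc unfolding all_bridges_def sole_crossing_def is_cycle_def by metis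
  obtain x y z zs where xs: "xs = x # y # z # zs"
    using cyc by (auto simp: is_cycle_def numeral_3_eq_3 Suc_le_length_iff)
  \<comment> \<open>The first vertex lies on no listed edge except \<open>{x, y}\<close>, and with
    at least three distinct vertices the last one is not \<open>y\<close>.\<close>
  have "?e \<notin> list_edges xs"
  proof
    assume "?e \<in> list_edges xs"
    moreover have "list_edges xs = insert {x, y} (list_edges (y # z # zs))" using xs by simp
    ultimately have "?e = {x, y} \<or> ?e \<subseteq> set (y # z # zs)"
      using list_edges_subset[of ?e "y # z # zs"] by (metis insertE)
    moreover have "last xs \<in> set (z # zs)" "hd xs = x" using xs by auto
    ultimately show False using cyc xs by (auto simp: is_cycle_def doubleton_eq_iff)
  qed
  then have "\<forall>f\<in>list_edges xs. \<not> crosses X f"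
    using X cyc by (auto simp: is_cycle_def walk_iff)
  then show False
    using hd_last_not_crossing[of xs X] X xs by auto
qed

lemma is_tree_iff:
  "is_tree V E \<longleftrightarrow> finite V \<and> V \<noteq> {} \<and> edges_on V E \<and> cut_connected V E \<and> all_bridges V E"
  unfolding is_tree_def
  using graph_connected_iff_cut_connected[of V E] acyclic_imp_all_bridges[of V E]
    all_bridges_imp_acyclic[of V E] by metis

section \<open>Exchanging edges of a tree\<close>

text \<open>Taking the cut of a vertex set is linear over the field with two elements.\<close>

lemma crosses_sym_diff:
  assumes "edges_on V E" "e \<in> E"
  shows "crosses (sym_diff X Y) e \<longleftrightarrow> crosses X e \<noteq> crosses Y e"
proof -
  obtain s t where "e = {s, t}" by (rule edges_on_obtain[OF assms])
  then show ?thesis by auto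
qed

lemma crosses_Diff_whole:
  assumes "edges_on V E" "e \<in> E"
  shows "crosses (V - X) e \<longleftrightarrow> crosses X e"
proof -
  obtain s t where "s \<in> V" "t \<in> V" "e = {s, t}" by (rule edges_on_obtain[OF assms])
  then show ?thesis by auto
qed

text \<open>Each cut of the old tree is corrected by adding \<open>X\<close>, the fundamental cut of
  \<open>f\<close>, whenever this is needed to adapt it to the new tree.\<close>

lemma tree_exchange:
  assumes T: "is_tree V T" and f: "f \<in> T" and X: "X \<subseteq> V" "sole_crossing T X f"
    and g: "u \<in> V" "w \<in> V" "g = {u, w}" "crosses X g"
  shows "is_tree V (insert g (T - {f}))" (is "is_tree V ?T")
proof -
  have on: "edges_on V T" and conn: "cut_connected V T" and br: "all_bridges V T"
    using T by (auto simp: is_tree_iff)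
  have "u \<noteq> w" using g by auto
  then have onI: "edges_on V (insert g T)" using edges_on_insert[OF on] g by simp
  then have on': "edges_on V ?T" by (rule edges_on_subset) auto
  obtain s t where st: "s \<in> V" "t \<in> V" "f = {s, t}" by (rule edges_on_obtain[OF on f])
  have "cut_connected V ?T"
    unfolding cut_connected_def
  proof (intro allI impI, rule ccontr)
    fix Y assume Y: "Y \<subseteq> V \<and> Y \<noteq> {} \<and> Y \<noteq> V" and no: "\<not> (\<exists>e\<in>?T. crosses Y e)"
    have fY: "crosses Y f" using conn Y no unfolding cut_connected_def by blast
    \<comment> \<open>In \<open>T\<close> both \<open>X\<close> and \<open>Y\<close> are crossed by
      \<open>f\<close> alone, so their sum is crossed by no edge of \<open>T\<close>; yet
      \<open>g\<close> crosses it, which rules out the trivial sets.\<close>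
    have "\<not> crosses (sym_diff X Y) e" if "e \<in> T" for e
    proof (cases "e = f")
      case True
      then show ?thesis using crosses_sym_diff[OF on that] X fY by (simp add: sole_crossing_def)
    next
      case False
      then show ?thesis using crosses_sym_diff[OF on that] X no that by (simp add: sole_crossing_def)
    qed
    then have "sym_diff X Y = {} \<or> sym_diff X Y = V"
      using cut_connectedD[OF conn, of "sym_diff X Y"] X Y by blast
    moreover have "\<not> crosses {} g" "\<not> crosses V g" using g by auto
    moreover have "crosses (sym_diff X Y) g"
      using crosses_sym_diff[OF onI, of g] g(4) no by simp
    ultimately show False by metis
  qed
  moreover have "all_bridges V ?T"
    unfolding all_bridges_def
  proof
    fix h assume h: "h \<in> ?T"
    show "\<exists>Z\<subseteq>V. sole_crossing ?T Z h"
    proof (cases "h = g")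
      case True
      then show ?thesis using X g by (intro exI[of _ X]) (auto simp: sole_crossing_def)
    next
      case False
      then have hT: "h \<in> T" "h \<noteq> f" using h by auto
      then obtain Z where Z: "Z \<subseteq> V" "sole_crossing T Z h" using br unfolding all_bridges_def by blast
      show ?thesis
      proof (cases "crosses Z g")
        case True
        \<comment> \<open>Adding \<open>X\<close> cancels the crossing by \<open>g\<close>. No edge
          of \<open>T\<close> other than \<open>f\<close> is affected, and \<open>f\<close> has been
          removed.\<close>
        have "sole_crossing ?T (sym_diff Z X) h"
          unfolding sole_crossing_def
        proof (intro conjI ballI)
          show "crosses (sym_diff Z X) h"
            using crosses_sym_diff[OF on hT(1)] Z X hT by (simp add: sole_crossing_def)
          fix k assume "k \<in> ?T - {h}"
          then show "\<not> crosses (sym_diff Z X) k"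
            using crosses_sym_diff[OF onI, of k] Z X g(4) True
            by (cases "k = g") (simp_all add: sole_crossing_def)
        qed
        moreover have "sym_diff Z X \<subseteq> V" using Z(1) X(1) by blast
        ultimately show ?thesis by (intro exI conjI)
      next
        case False
        then show ?thesis using Z \<open>h \<noteq> g\<close> by (intro exI[of _ Z]) (auto simp: sole_crossing_def)
      qed
    qed
  qed
  ultimately show ?thesis using T on' by (auto simp: is_tree_iff)
qed

text \<open>This finds an edge \<open>f\<close> of the tree path between the ends of
  \<open>g\<close> that crosses \<open>X\<close>, without speaking of the path. If the cut
  \<open>Z f\<close> of a crossing edge \<open>f\<close> is not crossed by \<open>g\<close>, adding
  \<open>Z f\<close> to \<open>X\<close> drops exactly \<open>f\<close> from the crossing tree edges
  and keeps \<open>g\<close> crossing; induction on their number ends the search.\<close>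

lemma exists_exchange_across_cut:
  assumes T: "is_tree V T" and X: "X \<subseteq> V" and g: "g \<subseteq> V" "crosses X g"
    and Z: "\<And>f. f \<in> T \<Longrightarrow> Z f \<subseteq> V \<and> sole_crossing T (Z f) f"
    and pair: "g = {u, w}"
  shows "\<exists>f\<in>T. crosses X f \<and> crosses (Z f) g"
  using X g(2)
proof (induction "card {f\<in>T. crosses X f}" arbitrary: X rule: less_induct)
  case less
  have on: "edges_on V T" and conn: "cut_connected V T" and fin: "finite V"
    using T by (auto simp: is_tree_iff)
  have finT: "finite T"
    by (rule finite_subset[of _ "Pow V"]) (use on fin in \<open>auto simp: edges_on_def\<close>)
  have "X \<noteq> {}" "X \<noteq> V" using less.prems g(1) pair by auto
  then obtain f where f: "f \<in> T" "crosses X f"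
    using conn less.prems unfolding cut_connected_def by blast
  show ?case
  proof (cases "crosses (Z f) g")
    case True
    then show ?thesis using f by blast
  next
    case False
    let ?X = "sym_diff X (Z f)"
    have eq: "{h\<in>T. crosses ?X h} = {h\<in>T. crosses X h} - {f}"
      using crosses_sym_diff[OF on] Z[OF f(1)] f by (auto simp: sole_crossing_def)
    have "card {h\<in>T. crosses ?X h} < card {h\<in>T. crosses X h}"
      unfolding eq using f finT by (intro psubset_card_mono) auto
    moreover have "?X \<subseteq> V" using less.prems Z[OF f(1)] by blast
    moreover have "crosses ?X g" using False less.prems unfolding pair by auto
    ultimately have "\<exists>h\<in>T. crosses ?X h \<and> crosses (Z h) g" by (rule less.hyps)
    then show ?thesis using eq by blast
  qed
qed

section \<open>Unique minimum spanning trees\<close>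

text \<open>The two orientations of the edge contribute \<open>2 * f s t\<close> before halving.
  Finiteness keeps the sums away from their default value 0.\<close>

lemma tree_weight_remove:
  assumes "finite T" "{s, t} \<in> T" "s \<noteq> t" "\<And>e. e \<in> T \<Longrightarrow> finite e" and sym: "\<And>u w. f u w = f w u"
  shows "tree_weight f T = tree_weight f (T - {{s, t}}) + f s t"
proof -
  let ?P = "\<lambda>T. {(u, w). {u, w} \<in> T \<and> u \<noteq> w}"
  have "?P T \<subseteq> \<Union>T \<times> \<Union>T" by auto
  moreover have "finite (\<Union>T)" using assms(1,4) by auto
  ultimately have fin: "finite (?P T)" by (meson finite_SigmaI finite_subset)
  have eq: "?P T = ?P (T - {{s, t}}) \<union> {(s, t), (t, s)}"
    using assms(2,3) by (auto simp: doubleton_eq_iff insert_commute)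
  have fin': "finite (?P (T - {{s, t}}))" by (rule finite_subset[OF _ fin]) auto
  have "sum (\<lambda>(u, w). f u w) (?P T) =
      sum (\<lambda>(u, w). f u w) (?P (T - {{s, t}})) + sum (\<lambda>(u, w). f u w) {(s, t), (t, s)}"
    unfolding eq by (rule sum.union_disjoint[OF fin']) (auto simp: insert_commute)
  also have "sum (\<lambda>(u, w). f u w) {(s, t), (t, s)} = 2 * f s t"
    using assms(3) sym[of s t] by simp
  finally show ?thesis unfolding tree_weight_def by simp
qed

text \<open>Were \<open>{u, w}\<close> not heavier, exchanging it for \<open>{s, t}\<close> would
  yield another minimum spanning tree. Uniqueness is what makes the inequality strict.\<close>

lemma unique_MST_exchange:
  assumes mst: "is_MST W f T" and uniq: "\<forall>T'. is_MST W f T' \<longrightarrow> T' = T"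
    and sym: "\<And>u w. f u w = f w u"
    and st: "{s, t} \<in> T" "X \<subseteq> W" "sole_crossing T X {s, t}"
    and uw: "u \<in> W" "w \<in> W" "crosses X {u, w}" "{u, w} \<noteq> {s, t}"
  shows "f s t < f u w"
proof (rule ccontr)
  assume "\<not> f s t < f u w"
  let ?U = "T - {{s, t}}"
  let ?T = "insert {u, w} ?U"
  have T: "is_tree W T" "T \<subseteq> complete_edges W"
    using mst by (auto simp: is_MST_def is_spanning_tree_of_complete_def)
  have tree: "is_tree W ?T"
    by (rule tree_exchange[OF T(1) st uw(1,2) refl uw(3)])
  have notin: "{u, w} \<notin> ?U" using st(3) uw(3) unfolding sole_crossing_def by blast
  have sub: "e \<subseteq> W" if "e \<in> insert {u, w} T" for e
    using T(2) uw that by (auto simp: complete_edges_def)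
  have "finite W" using T(1) by (simp add: is_tree_def)
  then have finI: "finite (insert {u, w} T)" and fine: "\<And>e. e \<in> insert {u, w} T \<Longrightarrow> finite e"
    using sub by (meson PowI finite_Pow_iff finite_subset subsetI)+
  have fin: "finite ?T" "finite T" by (rule finite_subset[OF _ finI]; blast)+
  have ne: "s \<noteq> t" "u \<noteq> w" using st(3) uw(3) by (auto simp: sole_crossing_def)
  have "?T - {{u, w}} = ?U" using notin by blast
  then have "tree_weight f ?T = tree_weight f ?U + f u w"
    using tree_weight_remove[of ?T u w f, OF fin(1) _ ne(2) fine sym] by auto
  moreover have "tree_weight f T = tree_weight f ?U + f s t"
    using tree_weight_remove[of T s t f, OF fin(2) st(1) ne(1) fine sym] by auto
  ultimately have "tree_weight f ?T \<le> tree_weight f T" using \<open>\<not> f s t < f u w\<close> by simp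
  moreover have "is_spanning_tree_of_complete W ?T"
    using tree T(2) uw ne by (auto simp: is_spanning_tree_of_complete_def complete_edges_def)
  ultimately have "is_MST W f ?T"
    using mst unfolding is_MST_def by (meson order_trans)
  then have "?T = T" by (rule uniq[rule_format])
  moreover have "{s, t} \<notin> ?T" using uw(4) by auto
  ultimately show False using st(1) by metis
qed

text \<open>If \<open>{u, w}\<close> were absent, some tree edge across \<open>X\<close> could be
  exchanged for it and would be strictly lighter, against \<open>min\<close>. Ties in
  \<open>min\<close> are harmless because the exchange inequality is strict.\<close>

lemma unique_MST_cut_property:
  assumes mst: "is_MST W f T" and uniq: "\<forall>T'. is_MST W f T' \<longrightarrow> T' = T"
    and sym: "\<And>u w. f u w = f w u"
    and X: "X \<subseteq> W" and u: "u \<in> X" and w: "w \<in> W" "w \<notin> X"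
    and min: "\<And>s t. s \<in> X \<Longrightarrow> t \<in> W \<Longrightarrow> t \<notin> X \<Longrightarrow> f u w \<le> f s t"
  shows "{u, w} \<in> T"
proof (rule ccontr)
  assume nin: "{u, w} \<notin> T"
  have T: "is_tree W T"
    using mst by (auto simp: is_MST_def is_spanning_tree_of_complete_def)
  then have "\<forall>e\<in>T. \<exists>Z\<subseteq>W. sole_crossing T Z e" by (simp add: is_tree_iff all_bridges_def)
  then obtain Z where Z: "\<And>e. e \<in> T \<Longrightarrow> Z e \<subseteq> W \<and> sole_crossing T (Z e) e" by metis
  have "{u, w} \<subseteq> W" "crosses X {u, w}" using X u w by auto
  from exists_exchange_across_cut[OF T X this Z refl]
  obtain e where e: "e \<in> T" "crosses X e" "crosses (Z e) {u, w}" by metis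
  obtain s t where st: "s \<in> W" "t \<in> W" "e = {s, t}" "s \<in> X" "t \<notin> X"
  proof -
    have "edges_on W T" using T by (simp add: is_tree_def)
    from this e(1) obtain s t where "s \<in> W" "t \<in> W" "e = {s, t}" by (rule edges_on_obtain)
    then show thesis using e(2) that[of s t] that[of t s] by (auto simp: insert_commute)
  qed
  have "f s t < f u w"
  proof (rule unique_MST_exchange[OF mst uniq sym])
    show "{s, t} \<in> T" "crosses (Z e) {u, w}" using e st by auto
    show "Z e \<subseteq> W" "sole_crossing T (Z e) {s, t}" using Z[OF e(1)] st by auto
    show "u \<in> W" "w \<in> W" using X u w by auto
    show "{u, w} \<noteq> {s, t}" using nin e st by auto
  qed
  then show False using min[of s t] st by simp
qed

text \<open>The fundamental cut of \<open>{s, t}\<close> separates \<open>z\<close> from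
  \<open>s\<close> or from \<open>t\<close>, so one of the other two sides of the triangle crosses
  it and would have to be strictly heavier.\<close>

lemma unique_MST_triangle_property:
  assumes mst: "is_MST W f T" and uniq: "\<forall>T'. is_MST W f T' \<longrightarrow> T' = T"
    and sym: "\<And>u w. f u w = f w u"
    and W: "s \<in> W" "t \<in> W" "z \<in> W" "z \<noteq> s" "z \<noteq> t"
    and le: "f s z \<le> f s t" "f t z \<le> f s t"
  shows "{s, t} \<notin> T"
proof
  assume st: "{s, t} \<in> T"
  have "all_bridges W T"
    using mst by (auto simp: is_MST_def is_spanning_tree_of_complete_def is_tree_iff)
  then obtain X where X: "X \<subseteq> W" "sole_crossing T X {s, t}"
    using st unfolding all_bridges_def by blast
  have ne: "{s, z} \<noteq> {s, t}" "{t, z} \<noteq> {s, t}" using W by (auto simp: doubleton_eq_iff)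
  have "crosses X {s, z} \<or> crosses X {t, z}" using X by (auto simp: sole_crossing_def)
  then have "f s t < f s z \<or> f s t < f t z"
    using unique_MST_exchange[OF mst uniq sym st X, of s z]
      unique_MST_exchange[OF mst uniq sym st X, of t z] W ne by argo
  then show False using le by linarith
qed

section \<open>Branches of a rooted tree\<close>

locale rooted_tree =
  fixes V :: "'v set" and E :: "'v set set" and rt :: 'v
  assumes tree: "is_tree V E" and root_in: "rt \<in> V"
begin

lemma
  shows fin_V: "finite V" and on: "edges_on V E" and conn: "cut_connected V E"
  using tree by (auto simp: is_tree_iff)

lemma fin_E: "finite E"
  by (rule finite_subset[of _ "Pow V"]) (use on fin_V in \<open>auto simp: edges_on_def\<close>)

text \<open>The component, after deletion of \<open>e\<close>, that avoids the root. A set as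
  required exists for every edge of the tree, by passing to the complement of a cut side if that
  side contains the root.\<close>

definition branch :: "'v set \<Rightarrow> 'v set" where
  "branch e = (SOME X. X \<subseteq> V \<and> rt \<notin> X \<and> sole_crossing E X e)"

lemma branch_props:
  assumes "e \<in> E"
  shows "branch e \<subseteq> V \<and> rt \<notin> branch e \<and> sole_crossing E (branch e) e"
proof -
  obtain X where X: "X \<subseteq> V" "sole_crossing E X e"
    using tree assms unfolding is_tree_iff all_bridges_def by metis
  have "sole_crossing E (V - X) e"
    using X(2) crosses_Diff_whole[OF on] assms by (simp add: sole_crossing_def)
  then have "\<exists>X. X \<subseteq> V \<and> rt \<notin> X \<and> sole_crossing E X e"
    using X by (cases "rt \<in> X") (auto intro: exI[of _ X] exI[of _ "V - X"])
  then show ?thesis unfolding branch_def by (rule someI_ex)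
qed

lemma branch_subset: "e \<in> E \<Longrightarrow> branch e \<subseteq> V"
  and root_notin_branch: "e \<in> E \<Longrightarrow> rt \<notin> branch e"
  using branch_props by auto

lemma branch_endpoints:
  assumes "{u, w} \<in> E"
  shows "u \<in> branch {u, w} \<longleftrightarrow> w \<notin> branch {u, w}"
  using branch_props[OF assms] by (auto simp: sole_crossing_def)

lemma branch_other_edge:
  assumes "e \<in> E" "{u, w} \<in> E" "{u, w} \<noteq> e"
  shows "u \<in> branch e \<longleftrightarrow> w \<in> branch e"
proof -
  have "\<not> crosses (branch e) {u, w}"
    using sole_crossingD[of E "branch e" e] branch_props[OF assms(1)] assms(2,3) by metis
  then show ?thesis by simp
qed

lemma adj_in_V: "{u, w} \<in> E \<Longrightarrow> u \<in> V \<and> w \<in> V \<and> u \<noteq> w"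
  by (rule edges_on_obtain[OF on, of "{u, w}"]) (auto simp: doubleton_eq_iff)

text \<open>The edge \<open>{c, b}\<close> does not cross \<open>X\<close> either, and
  \<open>X\<close> misses \<open>c\<close>. Inclusions between branches are proved by applying this
  to their differences.\<close>

lemma only_crossing_imp_trivial:
  assumes e: "{c, b} \<in> E" and X: "X \<subseteq> V" "c \<notin> X" "b \<notin> X"
    and nc: "\<And>f. f \<in> E \<Longrightarrow> f \<noteq> {c, b} \<Longrightarrow> \<not> crosses X f"
  shows "X = {}"
proof -
  have "X = {} \<or> X = V"
  proof (rule cut_connectedD[OF conn X(1)])
    fix f assume "f \<in> E"
    then show "\<not> crosses X f" using nc X by (cases "f = {c, b}") auto
  qed
  then show ?thesis using X adj_in_V[OF e] by auto
qed

text \<open>Neither edge crosses the branch of the other, so a Boolean combination of the branches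
  is crossed by at most \<open>e\<close> and \<open>f\<close>. The position of the edges selects a
  combination that contains no end of either edge, and it must be empty.\<close>

lemma branch_laminar:
  assumes e: "e \<in> E" and f: "f \<in> E"
  shows "branch e \<inter> branch f = {} \<or> branch e \<subseteq> branch f \<or> branch f \<subseteq> branch e"
proof (cases "e = f")
  case False
  let ?D = "branch e" and ?F = "branch f"
  obtain c b where cb: "e = {c, b}" "c \<in> ?D" "b \<notin> ?D" "b \<in> V"
  proof -
    obtain s t where st: "s \<in> V" "t \<in> V" "e = {s, t}" by (rule edges_on_obtain[OF on e])
    show thesis
      using branch_endpoints[of s t] e st that[of s t] that[of t s] by (auto simp: insert_commute)
  qed
  obtain s t where st: "f = {s, t}" "s \<in> V" "t \<in> V" by (rule edges_on_obtain[OF on f])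
  have st_e: "s \<in> ?D \<longleftrightarrow> t \<in> ?D" using branch_other_edge[OF e] f st False by auto
  have cb_f: "c \<in> ?F \<longleftrightarrow> b \<in> ?F" using branch_other_edge[OF f] e cb False by auto
  have other: "(y \<in> ?D \<longleftrightarrow> z \<in> ?D) \<and> (y \<in> ?F \<longleftrightarrow> z \<in> ?F)"
    if "g \<in> E" "g \<noteq> e" "g \<noteq> f" "g = {y, z}" for g y z
    using branch_other_edge[OF e] branch_other_edge[OF f] that by auto
  have sub: "?D \<subseteq> V" "?F \<subseteq> V" using branch_subset e f by auto
  \<comment> \<open>The premise \<open>bool\<close> expresses that, within \<open>V\<close>,
    membership in \<open>X\<close> depends only on membership in the two branches.\<close>
  have triv: "X = {}" if X: "X \<subseteq> V" "c \<notin> X" "b \<notin> X" "s \<in> X \<longleftrightarrow> t \<in> X"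
    and bool: "\<And>y z. y \<in> V \<Longrightarrow> z \<in> V \<Longrightarrow> (y \<in> ?D \<longleftrightarrow> z \<in> ?D) \<Longrightarrow> (y \<in> ?F \<longleftrightarrow> z \<in> ?F) \<Longrightarrow> (y \<in> X \<longleftrightarrow> z \<in> X)" for X
  proof (rule only_crossing_imp_trivial[of c b])
    show "{c, b} \<in> E" using e cb by simp
    fix g assume g: "g \<in> E" "g \<noteq> {c, b}"
    obtain y z where yz: "y \<in> V" "z \<in> V" "g = {y, z}" by (rule edges_on_obtain[OF on g(1)])
    show "\<not> crosses X g"
    proof (cases "g = f")
      case True
      then show ?thesis using X(4) st by simp
    next
      case False
      then have "y \<in> X \<longleftrightarrow> z \<in> X" using bool[OF yz(1,2)] other[of g y z] g yz cb by auto
      then show ?thesis using yz by simp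
    qed
  qed (use X in auto)
  show ?thesis
  proof (cases "s \<in> ?D")
    case False
    have "?D \<inter> ?F = {} \<or> ?D - ?F = {}"
    proof (cases "c \<in> ?F")
      case True
      then have "?D - ?F = {}" using sub cb False st_e by (intro triv) auto
      then show ?thesis ..
    next
      case c: False
      then have "?D \<inter> ?F = {}" using sub cb False st_e by (intro triv) auto
      then show ?thesis ..
    qed
    then show ?thesis by auto
  next
    case True
    have "b \<notin> ?F"
    proof
      assume "b \<in> ?F"
      \<comment> \<open>Otherwise the two branches would cover \<open>V\<close>, although the root
        lies in neither.\<close>
      then have "V - ?D - ?F = {}" using sub cb True st_e cb_f by (intro triv) auto
      then show False using root_in root_notin_branch e f by blast
    qed
    then have "?F - ?D = {}" using sub cb True st_e cb_f by (intro triv) auto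
    then show ?thesis by auto
  qed
qed auto

section \<open>Potentials and the inverse of the reduced Laplacian\<close>

text \<open>The level set of \<open>h\<close> through the root is crossed by no edge.\<close>

lemma const_of_edges:
  assumes "\<And>u w. {u, w} \<in> E \<Longrightarrow> h u = h w" "y \<in> V"
  shows "h y = h rt"
proof -
  let ?X = "{u\<in>V. h u = h rt}"
  have "?X = {} \<or> ?X = V"
  proof (rule cut_connectedD[OF conn])
    fix e assume e: "e \<in> E"
    obtain s t where "s \<in> V" "t \<in> V" "e = {s, t}" by (rule edges_on_obtain[OF on e])
    then show "\<not> crosses ?X e" using assms(1)[of s t] e by simp
  qed auto
  then show ?thesis using root_in assms(2) by auto
qed

text \<open>The potential difference between \<open>u\<close> and \<open>w\<close> under a unit
  injection at \<open>d\<close>: each edge above \<open>d\<close> counts with sign plus if only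
  \<open>u\<close> is below it, minus if only \<open>w\<close> is.\<close>

definition path_diff :: "('v set \<Rightarrow> real) \<Rightarrow> 'v \<Rightarrow> 'v \<Rightarrow> 'v \<Rightarrow> real" where
  "path_diff r u w d =
     (\<Sum>e\<in>{e\<in>E. d \<in> branch e}. r e * (of_bool (u \<in> branch e) - of_bool (w \<in> branch e)))"

lemma path_diff_edge:
  assumes "{c, b} \<in> E" "c \<in> branch {c, b}"
  shows "path_diff r c b d = (if d \<in> branch {c, b} then r {c, b} else 0)"
proof -
  let ?e = "{c, b}"
  have "b \<notin> branch ?e" using branch_endpoints assms by auto
  then have eq: "r e * (of_bool (c \<in> branch e) - of_bool (b \<in> branch e)) = (if e = ?e then r ?e else 0)"
    if "e \<in> E" for e
    using branch_other_edge[OF that assms(1)] assms by (cases "e = ?e") auto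
  have "path_diff r c b d = (\<Sum>e\<in>{e\<in>E. d \<in> branch e}. if e = ?e then r ?e else 0)"
    unfolding path_diff_def by (rule sum.cong) (use eq in auto)
  also have "\<dots> = (if ?e \<in> {e\<in>E. d \<in> branch e} then r ?e else 0)"
    using fin_E by (subst sum.delta) auto
  finally show ?thesis using assms by simp
qed

lemma path_diff_add: "path_diff r u w d + path_diff r w y d = path_diff r u y d"
  unfolding path_diff_def sum.distrib[symmetric] by (simp add: algebra_simps)

lemma path_diff_swap: "path_diff r w u d = - path_diff r u w d"
  unfolding path_diff_def sum_negf[symmetric] by (simp add: algebra_simps)

text \<open>Both sides drop by the same amount along every edge, so their difference is constant in
  the node.\<close>

lemma potential_eq_path_diff:
  assumes "\<And>c b. {c, b} \<in> E \<Longrightarrow> c \<in> branch {c, b} \<Longrightarrow>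
      g c - g b = (if d \<in> branch {c, b} then r {c, b} else 0)"
    and "u \<in> V" "w \<in> V"
  shows "g u - g w = path_diff r u w d"
proof -
  let ?h = "\<lambda>u. g u - path_diff r u rt d"
  have edge: "?h c = ?h b" if "{c, b} \<in> E" "c \<in> branch {c, b}" for c b
    using assms(1)[OF that] path_diff_edge[OF that, of r d] path_diff_add[of r c b d rt] by simp
  have "?h c = ?h b" if "{c, b} \<in> E" for c b
  proof (cases "c \<in> branch {c, b}")
    case False
    then have "{b, c} \<in> E" "b \<in> branch {b, c}"
      using branch_endpoints[OF that] that by (auto simp: insert_commute)
    from edge[OF this] show ?thesis by simp
  qed (use edge that in blast)
  then have "?h u = ?h rt" "?h w = ?h rt"
    using const_of_edges[of ?h] assms(2,3) by metis+
  then show ?thesis using path_diff_add[of r u w d rt] by simp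
qed

text \<open>Summing the Laplacian rows over a branch leaves only the flow through its edge.\<close>

lemma laplacian_inverse_edge:
  assumes inv: "is_inverse_on (V - {rt}) (laplacian E (\<lambda>e. 1 / r e)) G"
    and r: "\<forall>e\<in>E. r e > 0" and d: "d \<in> V - {rt}"
    and e: "{c, b} \<in> E" "c \<in> branch {c, b}"
  defines "g \<equiv> \<lambda>k. if k = rt then 0 else G k d"
  shows "g c - g b = (if d \<in> branch {c, b} then r {c, b} else 0)"
proof -
  let ?N = "V - {rt}" and ?D = "branch {c, b}"
  define A where "A a k = (if {a, k} \<in> E then 1 / r {a, k} else 0)" for a k
  have Asym: "A a k = A k a" for a k by (simp add: A_def insert_commute)
  have D: "?D \<subseteq> V" "rt \<notin> ?D" "b \<notin> ?D" "finite ?D"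
    using branch_subset[OF e(1)] root_notin_branch[OF e(1)] branch_endpoints[OF e(1)] e(2)
      finite_subset[OF _ fin_V] by auto
  \<comment> \<open>Potential 0 at the root lets the sum run over all of \<open>V\<close> and turns
    a Laplacian row into the total current leaving \<open>a\<close>, with conductances
    \<open>A\<close>.\<close>
  have row: "(\<Sum>k\<in>?N. laplacian E (\<lambda>e. 1 / r e) a k * G k d) = (\<Sum>k\<in>V. A a k * (g a - g k))"
    if a: "a \<in> ?N" for a
  proof -
    have noloop: "{a, a} \<notin> E" using adj_in_V[of a a] by auto
    have "{e\<in>E. a \<in> e} = (\<lambda>k. {a, k}) ` {k\<in>V. {a, k} \<in> E}" (is "?L = ?R")
    proof
      show "?L \<subseteq> ?R"
      proof
        fix e assume e: "e \<in> ?L"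
        then have "e \<in> E" by simp
        then obtain s t where "s \<in> V" "t \<in> V" "e = {s, t}" by (rule edges_on_obtain[OF on])
        with e show "e \<in> ?R" by (auto simp: insert_commute)
      qed
    qed auto
    moreover have "inj_on (\<lambda>k. {a, k}) {k\<in>V. {a, k} \<in> E}"
      by (auto simp: inj_on_def doubleton_eq_iff)
    ultimately have "(\<Sum>e\<in>{e\<in>E. a \<in> e}. 1 / r e) = (\<Sum>k\<in>{k\<in>V. {a, k} \<in> E}. 1 / r {a, k})"
      by (simp add: sum.reindex)
    also have "\<dots> = (\<Sum>k\<in>V. A a k)"
      unfolding A_def using fin_V by (simp add: sum.inter_filter)
    finally have diag: "laplacian E (\<lambda>e. 1 / r e) a a = (\<Sum>k\<in>V. A a k)"
      by (simp add: laplacian_def)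
    have "(\<Sum>k\<in>?N. laplacian E (\<lambda>e. 1 / r e) a k * G k d)
        = (\<Sum>k\<in>?N. laplacian E (\<lambda>e. 1 / r e) a k * g k)"
      by (rule sum.cong) (auto simp: g_def)
    also have "\<dots> = (\<Sum>k\<in>V. laplacian E (\<lambda>e. 1 / r e) a k * g k)"
      using sum.remove[OF fin_V root_in, of "\<lambda>k. laplacian E (\<lambda>e. 1 / r e) a k * g k"]
      by (simp add: g_def)
    also have "\<dots> = (\<Sum>k\<in>V. (if k = a then (\<Sum>k\<in>V. A a k) * g a else 0) - A a k * g k)"
      by (rule sum.cong) (use diag noloop in \<open>auto simp: laplacian_def A_def\<close>)
    also have "\<dots> = (\<Sum>k\<in>V. A a k) * g a - (\<Sum>k\<in>V. A a k * g k)"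
      using a fin_V by (simp add: sum_subtractf)
    also have "\<dots> = (\<Sum>k\<in>V. A a k * (g a - g k))"
      by (simp add: sum_distrib_right right_diff_distrib sum_subtractf)
    finally show ?thesis .
  qed
  have "(if d \<in> ?D then 1 else 0) = (\<Sum>a\<in>?D. if a = d then 1 else (0::real))"
    using D(4) by simp
  also have "\<dots> = (\<Sum>a\<in>?D. \<Sum>k\<in>V. A a k * (g a - g k))"
  proof (rule sum.cong[OF refl])
    fix a assume "a \<in> ?D"
    then have "a \<in> ?N" using D by auto
    then show "(if a = d then 1 else 0) = (\<Sum>k\<in>V. A a k * (g a - g k))"
      using row inv d unfolding is_inverse_on_def by auto
  qed
  also have "\<dots> = (\<Sum>a\<in>?D. \<Sum>k\<in>?D. A a k * (g a - g k)) + (\<Sum>a\<in>?D. \<Sum>k\<in>V - ?D. A a k * (g a - g k))"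
    unfolding sum.distrib[symmetric]
    by (rule sum.cong[OF refl], subst add.commute, rule sum.subset_diff[OF D(1) fin_V])
  \<comment> \<open>Currents inside the branch cancel in pairs: swapping the indices negates the
    sum.\<close>
  also have "(\<Sum>a\<in>?D. \<Sum>k\<in>?D. A a k * (g a - g k)) = 0"
  proof -
    have "(\<Sum>a\<in>?D. \<Sum>k\<in>?D. A a k * (g a - g k)) = (\<Sum>a\<in>?D. \<Sum>k\<in>?D. A k a * (g k - g a))"
      by (rule sum.swap)
    also have "\<dots> = - (\<Sum>a\<in>?D. \<Sum>k\<in>?D. A a k * (g a - g k))"
      unfolding sum_negf[symmetric] by (intro sum.cong refl) (simp add: Asym algebra_simps)
    finally show ?thesis by simp
  qed
  also have "(\<Sum>a\<in>?D. \<Sum>k\<in>V - ?D. A a k * (g a - g k))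
      = (\<Sum>a\<in>?D. \<Sum>k\<in>V - ?D. if a = c then if k = b then 1 / r {c, b} * (g c - g b) else 0 else 0)"
  proof (intro sum.cong refl)
    fix a k assume ak: "a \<in> ?D" "k \<in> V - ?D"
    \<comment> \<open>No other edge leaves the branch, so all current out of it flows from
      \<open>c\<close> to \<open>b\<close>.\<close>
    have "{a, k} = {c, b}" if "{a, k} \<in> E"
      using branch_other_edge[OF e(1) that] ak by auto
    then have ak_eq: "{a, k} \<in> E \<Longrightarrow> a = c \<and> k = b"
      using D ak e(2) by (auto simp: doubleton_eq_iff)
    show "A a k * (g a - g k) =
        (if a = c then if k = b then 1 / r {c, b} * (g c - g b) else 0 else 0)"
    proof (cases "{a, k} \<in> E")
      case True
      with ak_eq have "a = c" "k = b" by simp_all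
      then show ?thesis using e(1) by (simp add: A_def)
    next
      case False
      then have "\<not> (a = c \<and> k = b)" using e(1) by metis
      then show ?thesis using False by (simp add: A_def)
    qed
  qed
  also have "\<dots> = (\<Sum>a\<in>?D. if a = c then 1 / r {c, b} * (g c - g b) else 0)"
    using D fin_V adj_in_V[OF e(1)] by (intro sum.cong refl) auto
  also have "\<dots> = 1 / r {c, b} * (g c - g b)"
    using D e(2) by simp
  finally show ?thesis using r e(1) by (auto simp: field_simps split: if_splits)
qed

lemma laplacian_inverse_diff:
  assumes "is_inverse_on (V - {rt}) (laplacian E (\<lambda>e. 1 / r e)) G"
    and "\<forall>e\<in>E. r e > 0" and "d \<in> V - {rt}" and "u \<in> V" "w \<in> V"
  shows "(if u = rt then 0 else G u d) - (if w = rt then 0 else G w d) = path_diff r u w d"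
  by (rule potential_eq_path_diff[OF laplacian_inverse_edge[OF assms(1-3)] assms(4,5)])

text \<open>The tree path from \<open>u\<close> to \<open>w\<close> climbs through the edges of
  \<open>sep u w\<close> and descends through those of \<open>sep w u\<close>.\<close>

definition sep :: "'v \<Rightarrow> 'v \<Rightarrow> 'v set set" where
  "sep u w = {e\<in>E. u \<in> branch e \<and> w \<notin> branch e}"

text \<open>By laminarity, the edges above \<open>d\<close> cannot separate \<open>u\<close> from \<open>w\<close> in both directions,
  so all terms of \<^const>\<open>path_diff\<close> have the same sign.\<close>

lemma path_diff_mono:
  assumes sub: "sep u' w' \<subseteq> sep u w" "sep w' u' \<subseteq> sep w u"
  shows "(\<forall>r. (\<forall>e\<in>E. 0 < r e) \<longrightarrow> 0 \<le> path_diff r u' w' d \<and> path_diff r u' w' d \<le> path_diff r u w d) \<or>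
    (\<forall>r. (\<forall>e\<in>E. 0 < r e) \<longrightarrow> 0 \<le> path_diff r w' u' d \<and> path_diff r w' u' d \<le> path_diff r w u d)"
proof -
  have mono: "0 \<le> path_diff r u' w' d \<and> path_diff r u' w' d \<le> path_diff r u w d"
    if r: "\<forall>e\<in>E. 0 < r e" and sub: "sep u' w' \<subseteq> sep u w" "sep w' u' \<subseteq> sep w u"
      and no: "\<And>e. e \<in> sep w u \<Longrightarrow> d \<notin> branch e" for r u w u' w'
  proof -
    have le: "0 \<le> r e * (of_bool (u' \<in> branch e) - of_bool (w' \<in> branch e)) \<and>
      r e * (of_bool (u' \<in> branch e) - of_bool (w' \<in> branch e))
        \<le> r e * (of_bool (u \<in> branch e) - of_bool (w \<in> branch e))"
      if "e \<in> {e\<in>E. d \<in> branch e}" for e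
    proof -
      have "r e > 0" "\<not> (w \<in> branch e \<and> u \<notin> branch e)" "\<not> (w' \<in> branch e \<and> u' \<notin> branch e)"
        "u' \<in> branch e \<and> w' \<notin> branch e \<longrightarrow> u \<in> branch e \<and> w \<notin> branch e"
        using r that sub no[of e] by (auto simp: sep_def)
      then show ?thesis by (auto simp: of_bool_def)
    qed
    then show ?thesis
      unfolding path_diff_def by (intro conjI sum_nonneg sum_mono) auto
  qed
  \<comment> \<open>Branches of two edges above \<open>d\<close> meet in \<open>d\<close> and hence
    are nested, which excludes opposite separations. The orientation found here does not depend on
    \<open>r\<close>, so it serves resistances and reactances at once.\<close>
  have "(\<forall>e\<in>sep w u. d \<notin> branch e) \<or> (\<forall>e\<in>sep u w. d \<notin> branch e)"
  proof (rule ccontr)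
    assume "\<not> ?thesis"
    then obtain e f where "e \<in> E" "f \<in> E" "w \<in> branch e" "u \<notin> branch e" "d \<in> branch e"
      "u \<in> branch f" "w \<notin> branch f" "d \<in> branch f" by (auto simp: sep_def)
    then show False using branch_laminar[of e f] by auto
  qed
  then show ?thesis using mono[OF _ sub] mono[OF _ sub(2,1)] by metis
qed

section \<open>Paths to the root and the parent relation\<close>

lemma simple_path_exists: "u \<in> V \<Longrightarrow> \<exists>xs. simple_path E u rt xs"
  using tree root_in walk_imp_simple_path unfolding is_tree_def graph_connected_def by metis

lemma branch_const_on_list:
  assumes "e \<in> E" "walk E xs" "e \<notin> list_edges xs"
  shows "hd xs \<in> branch e \<longleftrightarrow> last xs \<in> branch e"
proof (rule hd_last_not_crossing)
  show "xs \<noteq> []" using assms by (simp add: walk_iff)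
  show "\<forall>f\<in>list_edges xs. \<not> crosses (branch e) f"
  proof
    fix f assume "f \<in> list_edges xs"
    then have "f \<in> E" "f \<noteq> e" using assms by (auto simp: walk_iff)
    then show "\<not> crosses (branch e) f"
      using branch_props[OF assms(1)] sole_crossingD[of E "branch e" e f] by simp
  qed
qed

text \<open>A walk from inside \<open>branch e\<close> to the root has to leave through
  \<open>e\<close> and so visits both its ends.\<close>

lemma simple_path_to_root_avoids:
  assumes "simple_path E u rt xs" "e \<in> E" "\<not> e \<subseteq> set xs"
  shows "u \<notin> branch e"
  using branch_const_on_list[OF assms(2), of xs] assms list_edges_subset[of e xs]
    root_notin_branch[OF assms(2)] by (auto simp: simple_path_def)

text \<open>Uniqueness evaluates the \<open>THE\<close> in \<open>path_edges\<close>. Two different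
  first steps from \<open>x\<close> to \<open>y\<close> and \<open>y'\<close> cannot occur: both
  remainders avoid \<open>x\<close>, so \<open>x\<close> is in \<open>branch {x, y}\<close> while
  \<open>y'\<close> is not, and \<open>{x, y'}\<close> would cross that branch.\<close>

lemma simple_path_unique:
  assumes "simple_path E u rt xs" "simple_path E u rt ys"
  shows "xs = ys"
  using assms
proof (induction xs arbitrary: u ys rule: induct_list012)
  case 1
  then show ?case by (simp add: simple_path_def walk_iff)
next
  case (2 x)
  then have "x = rt" "u = rt" by (auto simp: simple_path_def)
  then show ?case
    using 2 by (cases ys) (auto simp: simple_path_def walk_iff split: if_splits)
next
  case (3 x y zs)
  have u: "u = x" "{x, y} \<in> E" and xs: "simple_path E y rt (y # zs)" "x \<notin> set (y # zs)"
    using 3 by (auto simp: simple_path_def walk_iff)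
  have "rt \<in> set (y # zs)" using xs(1) by (metis last_in_set list.distinct(1) simple_path_def)
  then have "x \<noteq> rt" using xs(2) by auto
  then obtain y' zs' where ys: "ys = x # y' # zs'"
    using 3 u by (metis last.simps list.exhaust list.sel(1) simple_path_def walk_iff)
  have ys': "simple_path E y' rt (y' # zs')" "x \<notin> set (y' # zs')" "{x, y'} \<in> E"
    using 3 unfolding ys by (auto simp: simple_path_def walk_iff)
  have "y = y'"
  proof (rule ccontr)
    assume ne: "y \<noteq> y'"
    have "y \<notin> branch {x, y}" using simple_path_to_root_avoids[OF xs(1) u(2)] xs by auto
    then have "x \<in> branch {x, y}" using branch_endpoints[OF u(2)] by auto
    moreover have "y' \<notin> branch {x, y}" using simple_path_to_root_avoids[OF ys'(1) u(2)] ys' by auto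
    moreover have "{x, y'} \<noteq> {x, y}" using ne by (auto simp: doubleton_eq_iff)
    ultimately show False using branch_other_edge[OF u(2) ys'(3)] by auto
  qed
  then show ?case using "3.IH"(2)[OF xs(1)] ys' ys u by auto
qed

lemma path_edges_eq:
  assumes "simple_path E u rt xs"
  shows "path_edges E rt u = list_edges xs"
proof -
  have "(THE xs. simple_path E u rt xs) = xs"
    using assms simple_path_unique by blast
  then show ?thesis by (simp add: path_edges_def list_edges_def)
qed

text \<open>If \<open>b\<close> were the lower end, its path to the root would use
  \<open>{c, b}\<close>, hence so would the path of \<open>c\<close>; the latter would then start
  with \<open>c\<close>, \<open>b\<close> and continue from \<open>b\<close> avoiding
  \<open>c\<close>, which is impossible. If \<open>c\<close> is the lower end, the path of
  \<open>b\<close> avoids \<open>c\<close> and extends to one of \<open>c\<close>.\<close>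

lemma parent_of_iff: "parent_of E rt b c \<longleftrightarrow> {c, b} \<in> E \<and> c \<in> branch {c, b}"
proof (cases "{c, b} \<in> E")
  case e: True
  let ?e = "{c, b}"
  have V: "c \<in> V" "b \<in> V" "c \<noteq> b" using adj_in_V[OF e] by auto
  obtain xs where xs: "simple_path E b rt xs" using simple_path_exists[OF V(2)] by blast
  then obtain xs' where xs': "xs = b # xs'" by (cases xs) (auto simp: simple_path_def walk_iff)
  obtain ys where ys: "simple_path E c rt ys" using simple_path_exists[OF V(1)] by blast
  then obtain ys' where ys': "ys = c # ys'" by (cases ys) (auto simp: simple_path_def walk_iff)
  show ?thesis
  proof
    assume "parent_of E rt b c"
    then have sub: "list_edges xs \<subseteq> list_edges ys"
      using path_edges_eq[OF xs] path_edges_eq[OF ys] by (simp add: parent_of_def)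
    have "c \<in> branch ?e"
    proof (rule ccontr)
      assume c: "c \<notin> branch ?e"
      then have b: "b \<in> branch ?e" using branch_endpoints[OF e] by auto
      then have "?e \<in> list_edges xs"
        using branch_const_on_list[OF e, of xs] xs root_notin_branch[OF e]
        by (auto simp: simple_path_def)
      then have in_ys: "?e \<in> list_edges ys" using sub by auto
      then obtain z zs where zs: "ys' = z # zs" using ys' by (cases ys') auto
      have "c \<notin> set ys'" using ys ys' by (simp add: simple_path_def)
      then have "?e \<notin> list_edges ys'" using list_edges_subset[of ?e ys'] by auto
      then have "?e = {c, z}" using in_ys ys' zs by simp
      then have "z = b" by (auto simp: doubleton_eq_iff)
      then have "simple_path E b rt ys'" using ys ys' zs by (auto simp: simple_path_def walk_iff)
      then show False using simple_path_to_root_avoids[OF _ e] \<open>c \<notin> set ys'\<close> b by auto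
    qed
    then show "?e \<in> E \<and> c \<in> branch ?e" using e by simp
  next
    assume "?e \<in> E \<and> c \<in> branch ?e"
    then have c: "c \<in> branch ?e" by simp
    have "c \<notin> set xs"
    proof
      assume "c \<in> set xs"
      then have "c \<in> set xs'" using V xs' by auto
      then obtain l m where lm: "xs' = l @ c # m" by (meson split_list)
      have "b \<notin> set (c # m)" using xs xs' lm by (auto simp: simple_path_def)
      moreover have "simple_path E c rt (c # m)"
        using xs list_edges_append_subset[of "c # m" "b # l"]
        unfolding xs' lm by (auto simp: simple_path_def walk_iff)
      ultimately show False using simple_path_to_root_avoids[OF _ e] c by auto
    qed
    then have "simple_path E c rt (c # xs)"
      using xs xs' e by (auto simp: simple_path_def walk_iff)
    then have "path_edges E rt c = insert ?e (list_edges xs)"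
      using path_edges_eq xs' by simp
    then show "parent_of E rt b c"
      using e path_edges_eq[OF xs] by (auto simp: parent_of_def)
  qed
qed (simp add: parent_of_def)

lemma child_iff: "c \<in> children E rt b \<longleftrightarrow> {c, b} \<in> E \<and> c \<in> branch {c, b}"
  by (simp add: children_def parent_of_iff)

section \<open>Branches around a node and its children\<close>

text \<open>Both branches contain \<open>c\<close>, but only the upper one contains
  \<open>b\<close>, so laminarity leaves one inclusion.\<close>

lemma branch_child_subset:
  assumes a: "parent_of E rt a b" and c: "c \<in> children E rt b"
  shows "branch {c, b} \<subseteq> branch {b, a}"
proof -
  have e: "{b, a} \<in> E" "b \<in> branch {b, a}" "a \<notin> branch {b, a}"
    and f: "{c, b} \<in> E" "c \<in> branch {c, b}" "b \<notin> branch {c, b}"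
    using a c branch_endpoints unfolding parent_of_iff child_iff by blast+
  have "{c, b} \<noteq> {b, a}" using e f by metis
  then have "c \<in> branch {b, a}" using branch_other_edge[OF e(1) f(1)] e by auto
  then show ?thesis using branch_laminar[OF e(1) f(1)] e f by auto
qed

lemma branch_siblings_disjoint:
  assumes "c \<in> children E rt b" "c' \<in> children E rt b" "c \<noteq> c'"
  shows "branch {c, b} \<inter> branch {c', b} = {}"
proof -
  have e: "{c, b} \<in> E" "c \<in> branch {c, b}" "b \<notin> branch {c, b}"
    and f: "{c', b} \<in> E" "c' \<in> branch {c', b}" "b \<notin> branch {c', b}"
    using assms branch_endpoints unfolding child_iff by blast+
  have "{c, b} \<noteq> {c', b}" using assms(3) by (auto simp: doubleton_eq_iff)
  then have "c \<notin> branch {c', b}" "c' \<notin> branch {c, b}"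
    using branch_other_edge[OF e(1) f(1)] branch_other_edge[OF f(1) e(1)] e f by auto
  then show ?thesis using branch_laminar[OF e(1) f(1)] e f by auto
qed

text \<open>The set \<open>?X\<close> of exceptions contains neither \<open>a\<close> nor
  \<open>b\<close>, and no edge other than \<open>{b, a}\<close> could cross it, so it is
  empty.\<close>

lemma branch_decomposition:
  assumes a: "parent_of E rt a b" and w: "w \<in> branch {b, a}" "w \<noteq> b"
  shows "\<exists>c\<in>children E rt b. w \<in> branch {c, b}"
proof -
  let ?B = "branch {b, a}"
  let ?X = "{w \<in> ?B. w \<noteq> b \<and> (\<forall>c\<in>children E rt b. w \<notin> branch {c, b})}"
  have e: "{b, a} \<in> E" "b \<in> ?B" "a \<notin> ?B"
    using a branch_endpoints unfolding parent_of_iff by blast+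
  have half: "t \<in> ?X" if st: "{s, t} \<in> E" "{s, t} \<noteq> {b, a}" and s: "s \<in> ?X" for s t
  proof -
    have tB: "t \<in> ?B" using branch_other_edge[OF e(1) st] s by auto
    \<comment> \<open>Otherwise \<open>s\<close> is a neighbour of \<open>b\<close> but not a child,
      so \<open>b\<close> and with it \<open>a\<close> lie in \<open>branch {s, b}\<close>. That
      branch meets \<open>?B\<close> in \<open>b\<close>, while \<open>a\<close> and
      \<open>s\<close> prevent either inclusion.\<close>
    have "t \<noteq> b"
    proof
      assume "t = b"
      then have sb: "{s, b} \<in> E" using st by simp
      have "s \<notin> branch {s, b}" using s sb unfolding child_iff[symmetric] by (auto simp: child_iff)
      then have b: "b \<in> branch {s, b}" using branch_endpoints[OF sb] by auto
      have "{b, a} \<noteq> {s, b}" using st \<open>t = b\<close> by auto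
      then have "a \<in> branch {s, b}" using branch_other_edge[OF sb e(1)] b by auto
      then show False
        using branch_laminar[OF sb e(1)] b e s \<open>s \<notin> branch {s, b}\<close> by auto
    qed
    moreover have "t \<notin> branch {c, b}" if c: "c \<in> children E rt b" for c
    proof
      assume t: "t \<in> branch {c, b}"
      have cb: "{c, b} \<in> E" "b \<notin> branch {c, b}"
        using c branch_endpoints unfolding child_iff by blast+
      have "s \<notin> branch {c, b}" using s c by auto
      then have "{s, t} = {c, b}" using branch_other_edge[OF cb(1) st(1)] t by auto
      then show False using s \<open>t \<noteq> b\<close> by (auto simp: doubleton_eq_iff)
    qed
    ultimately show ?thesis using tB by simp
  qed
  have "?X = {}"
  proof (rule only_crossing_imp_trivial[OF e(1)])
    show "?X \<subseteq> V" using branch_subset[OF e(1)] by auto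
    show "b \<notin> ?X" "a \<notin> ?X" using e by auto
    fix f assume f: "f \<in> E" "f \<noteq> {b, a}"
    obtain s t where st: "f = {s, t}" by (rule edges_on_obtain[OF on f(1)])
    have "{s, t} \<in> E" "{s, t} \<noteq> {b, a}" "{t, s} \<in> E" "{t, s} \<noteq> {b, a}"
      using f st by (simp_all add: insert_commute)
    then have "s \<in> ?X \<longleftrightarrow> t \<in> ?X" using half[of s t] half[of t s] by (intro iffI)
    then show "\<not> crosses ?X f" unfolding st crosses_pair by (rule notI[OF notE, rotated])
  qed
  then show ?thesis using w by auto
qed

lemma sep_child_parent:
  assumes "c \<in> children E rt b"
  shows "sep c b = {{c, b}}" "sep b c = {}"
proof -
  have e: "{c, b} \<in> E" "c \<in> branch {c, b}" "b \<notin> branch {c, b}"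
    using assms branch_endpoints unfolding child_iff by blast+
  then show "sep c b = {{c, b}}" "sep b c = {}"
    using branch_other_edge[OF _ e(1)] by (auto simp: sep_def)
qed

lemma sep_trans: "sep u y \<subseteq> sep u w \<union> sep w y"
  by (auto simp: sep_def)

end

section \<open>Voltage covariances\<close>

context rooted_tree
begin

text \<open>The closed form of \<open>phi\<close>: \<open>P\<close>, \<open>Q\<close> and
  \<open>C\<close> stand for the variances of \<open>p\<close>, of \<open>q\<close> and their
  covariance at a node, and the path differences are the coefficients of the injections in the
  voltage difference.\<close>

definition diff_form ::
    "('v set \<Rightarrow> real) \<Rightarrow> ('v set \<Rightarrow> real) \<Rightarrow> ('v \<Rightarrow> real) \<Rightarrow> ('v \<Rightarrow> real) \<Rightarrow> ('v \<Rightarrow> real) \<Rightarrow> 'v \<Rightarrow> 'v \<Rightarrow> real"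
  where "diff_form r x P Q C u w = (\<Sum>d\<in>V - {rt}. (path_diff r u w d)\<^sup>2 * P d + (path_diff x u w d)\<^sup>2 * Q d
    + 2 * (path_diff r u w d * path_diff x u w d) * C d)"

text \<open>For each \<open>d\<close>, reversing both pairs of nodes if necessary makes all path
  differences nonnegative and ordered. Reversal changes no square or product, and the form is
  monotone as its coefficients are nonnegative.\<close>

lemma diff_form_mono:
  assumes pos: "\<forall>e\<in>E. 0 < r e" "\<forall>e\<in>E. 0 < x e"
    and nonneg: "\<And>d. d \<in> V - {rt} \<Longrightarrow> 0 \<le> P d \<and> 0 \<le> Q d \<and> 0 \<le> C d"
    and sub: "sep u' w' \<subseteq> sep u w" "sep w' u' \<subseteq> sep w u"
  shows "diff_form r x P Q C u' w' \<le> diff_form r x P Q C u w"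
  unfolding diff_form_def
proof (rule sum_mono)
  fix d assume d: "d \<in> V - {rt}"
  have mono: "\<alpha>'\<^sup>2 * P d + \<beta>'\<^sup>2 * Q d + 2 * (\<alpha>' * \<beta>') * C d \<le> \<alpha>\<^sup>2 * P d + \<beta>\<^sup>2 * Q d + 2 * (\<alpha> * \<beta>) * C d"
    if "0 \<le> \<alpha>'" "\<alpha>' \<le> \<alpha>" "0 \<le> \<beta>'" "\<beta>' \<le> \<beta>" for \<alpha> \<alpha>' \<beta> \<beta>' :: real
    using nonneg[OF d] that by (intro add_mono mult_mono power_mono) auto
  from path_diff_mono[OF sub, of d]
  consider "0 \<le> path_diff r u' w' d" "path_diff r u' w' d \<le> path_diff r u w d"
      "0 \<le> path_diff x u' w' d" "path_diff x u' w' d \<le> path_diff x u w d"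
    | "0 \<le> path_diff r w' u' d" "path_diff r w' u' d \<le> path_diff r w u d"
      "0 \<le> path_diff x w' u' d" "path_diff x w' u' d \<le> path_diff x w u d"
    using pos by blast
  then show "(path_diff r u' w' d)\<^sup>2 * P d + (path_diff x u' w' d)\<^sup>2 * Q d
        + 2 * (path_diff r u' w' d * path_diff x u' w' d) * C d
      \<le> (path_diff r u w d)\<^sup>2 * P d + (path_diff x u w d)\<^sup>2 * Q d
        + 2 * (path_diff r u w d * path_diff x u w d) * C d"
  proof cases
    case 1
    then show ?thesis by (rule mono)
  next
    case 2
    from mono[OF 2] show ?thesis
      by (simp add: path_diff_swap[of _ w' u'] path_diff_swap[of _ w u])
  qed
qed

text \<open>No \<open>d\<close> lies below both sibling edges, so one of the two path differences
  from \<open>b\<close> vanishes and the cross terms disappear.\<close>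

lemma diff_form_siblings:
  assumes c: "c \<in> children E rt b" "c' \<in> children E rt b" "c \<noteq> c'"
  shows "diff_form r x P Q C c c' = diff_form r x P Q C b c + diff_form r x P Q C b c'"
  unfolding diff_form_def sum.distrib[symmetric]
proof (rule sum.cong[OF refl])
  fix d assume "d \<in> V - {rt}"
  have disj: "\<not> (d \<in> branch {c, b} \<and> d \<in> branch {c', b})"
    using branch_siblings_disjoint[OF c] by auto
  have b: "path_diff k b c d = - (if d \<in> branch {c, b} then k {c, b} else 0)"
    "path_diff k b c' d = - (if d \<in> branch {c', b} then k {c', b} else 0)" for k
    using path_diff_edge[of c b k d] path_diff_edge[of c' b k d] c
      path_diff_swap[of k b c d] path_diff_swap[of k b c' d]
    unfolding child_iff by simp_all
  have cc: "path_diff k c c' d = path_diff k b c' d - path_diff k b c d" for k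
    using path_diff_add[of k b c d c'] by simp
  show "(path_diff r c c' d)\<^sup>2 * P d + (path_diff x c c' d)\<^sup>2 * Q d
        + 2 * (path_diff r c c' d * path_diff x c c' d) * C d
      = (path_diff r b c d)\<^sup>2 * P d + (path_diff x b c d)\<^sup>2 * Q d
        + 2 * (path_diff r b c d * path_diff x b c d) * C d
        + ((path_diff r b c' d)\<^sup>2 * P d + (path_diff x b c' d)\<^sup>2 * Q d
        + 2 * (path_diff r b c' d * path_diff x b c' d) * C d)"
    unfolding cc b using disj by auto
qed

text \<open>With \<open>w \<noteq> b\<close>, leaving the branch means either entering that of a
  sibling \<open>c'\<close> or leaving \<open>branch {b, a}\<close>. The path from \<open>u\<close>
  to \<open>w\<close> then contains that from \<open>c\<close> to \<open>c'\<close> or to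
  \<open>a\<close>, and monotonicity applies.\<close>

lemma diff_form_branch_exit:
  assumes pos: "\<forall>e\<in>E. 0 < r e" "\<forall>e\<in>E. 0 < x e"
    and nonneg: "\<And>d. d \<in> V - {rt} \<Longrightarrow> 0 \<le> P d \<and> 0 \<le> Q d \<and> 0 \<le> C d"
    and a: "parent_of E rt a b" and c: "c \<in> children E rt b"
    and u: "u \<in> branch {c, b}" and w: "w \<notin> branch {c, b}" "w \<noteq> b"
  shows "diff_form r x P Q C a c \<le> diff_form r x P Q C u w \<or>
    (\<exists>c'\<in>children E rt b. c' \<noteq> c \<and> diff_form r x P Q C c c' \<le> diff_form r x P Q C u w)"
proof (cases "w \<in> branch {b, a}")
  case True
  then obtain c' where c': "c' \<in> children E rt b" "w \<in> branch {c', b}"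
    using branch_decomposition[OF a] w by blast
  have ne: "c' \<noteq> c" using c' w by auto
  have "u \<notin> branch {c', b}" using branch_siblings_disjoint[OF c c'(1)] ne u by auto
  then have uw: "{{c, b}} \<subseteq> sep u w" "{{c', b}} \<subseteq> sep w u"
    using c c' u w by (auto simp: sep_def child_iff)
  have "sep c c' \<subseteq> {{c, b}}" "sep c' c \<subseteq> {{c', b}}"
    using sep_trans[of c c' b] sep_trans[of c' c b] sep_child_parent[OF c] sep_child_parent[OF c'(1)]
    by auto
  then have "sep c c' \<subseteq> sep u w" "sep c' c \<subseteq> sep w u" using uw by (meson order_trans)+
  from diff_form_mono[where P=P and Q=Q and C=C, OF pos nonneg this] show ?thesis
    using c'(1) ne by blast
next
  case False
  have b: "b \<in> children E rt a" using a by (simp add: children_def)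
  have "u \<in> branch {b, a}" using branch_child_subset[OF a c] u by auto
  then have uw: "{{c, b}, {b, a}} \<subseteq> sep u w"
    using c b u w False by (auto simp: sep_def child_iff)
  have "sep c a \<subseteq> {{c, b}, {b, a}}" "sep a c \<subseteq> {}"
    using sep_trans[of c a b] sep_trans[of a c b] sep_child_parent[OF c] sep_child_parent[OF b]
    by auto
  then have "sep c a \<subseteq> sep u w" "sep a c \<subseteq> sep w u" using uw by auto
  from diff_form_mono[where P=P and Q=Q and C=C, OF pos nonneg this]
  have "diff_form r x P Q C c a \<le> diff_form r x P Q C u w" .
  moreover have "diff_form r x P Q C c a = diff_form r x P Q C a c"
    unfolding diff_form_def by (simp add: path_diff_swap[of _ c a])
  ultimately show ?thesis by simp
qed

end

section \<open>Second moments of uncorrelated injections\<close>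

lemma (in prob_space) integrable_mult_of_squares:
  fixes f g :: "'a \<Rightarrow> real"
  assumes [measurable]: "f \<in> borel_measurable M" "g \<in> borel_measurable M"
    and "integrable M (\<lambda>\<omega>. (f \<omega>)\<^sup>2)" "integrable M (\<lambda>\<omega>. (g \<omega>)\<^sup>2)"
  shows "integrable M (\<lambda>\<omega>. f \<omega> * g \<omega>)"
proof (rule Bochner_Integration.integrable_bound)
  show "integrable M (\<lambda>\<omega>. (f \<omega>)\<^sup>2 + (g \<omega>)\<^sup>2)" using assms by simp
  have "\<bar>y * z\<bar> \<le> \<bar>y\<^sup>2 + z\<^sup>2\<bar>" for y z :: real
  proof -
    have "2 * \<bar>y\<bar> * \<bar>z\<bar> \<le> \<bar>y\<bar>\<^sup>2 + \<bar>z\<bar>\<^sup>2" by (rule sum_squares_bound)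
    moreover have "0 \<le> \<bar>y\<bar> * \<bar>z\<bar>" by simp
    moreover have "\<bar>y * z\<bar> = \<bar>y\<bar> * \<bar>z\<bar>" "\<bar>y\<^sup>2 + z\<^sup>2\<bar> = \<bar>y\<bar>\<^sup>2 + \<bar>z\<bar>\<^sup>2"
      by (simp_all add: abs_mult)
    ultimately show ?thesis by linarith
  qed
  then show "AE \<omega> in M. norm (f \<omega> * g \<omega>) \<le> norm ((f \<omega>)\<^sup>2 + (g \<omega>)\<^sup>2)" by simp
qed simp

text \<open>In the expanded square only equal indices survive. Mixed moments of \<open>Q\<close> and
  \<open>P\<close> occur in both index orders, so the third condition is applied twice.\<close>

lemma (in prob_space) integral_square_sum_uncorrelated:
  fixes P Q :: "'v \<Rightarrow> 'a \<Rightarrow> real" and \<alpha> \<beta> :: "'v \<Rightarrow> real"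
  assumes fin: "finite N"
    and meas: "\<And>d. d \<in> N \<Longrightarrow> P d \<in> borel_measurable M" "\<And>d. d \<in> N \<Longrightarrow> Q d \<in> borel_measurable M"
    and sq: "\<And>d. d \<in> N \<Longrightarrow> integrable M (\<lambda>\<omega>. (P d \<omega>)\<^sup>2)"
      "\<And>d. d \<in> N \<Longrightarrow> integrable M (\<lambda>\<omega>. (Q d \<omega>)\<^sup>2)"
    and unc: "\<And>c d. c \<in> N \<Longrightarrow> d \<in> N \<Longrightarrow> c \<noteq> d \<Longrightarrow> expectation (\<lambda>\<omega>. P c \<omega> * P d \<omega>) = 0"
      "\<And>c d. c \<in> N \<Longrightarrow> d \<in> N \<Longrightarrow> c \<noteq> d \<Longrightarrow> expectation (\<lambda>\<omega>. Q c \<omega> * Q d \<omega>) = 0"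
      "\<And>c d. c \<in> N \<Longrightarrow> d \<in> N \<Longrightarrow> c \<noteq> d \<Longrightarrow> expectation (\<lambda>\<omega>. Q c \<omega> * P d \<omega>) = 0"
  shows "expectation (\<lambda>\<omega>. (\<Sum>d\<in>N. \<alpha> d * P d \<omega> + \<beta> d * Q d \<omega>)\<^sup>2) =
    (\<Sum>d\<in>N. (\<alpha> d)\<^sup>2 * expectation (\<lambda>\<omega>. P d \<omega> * P d \<omega>) + (\<beta> d)\<^sup>2 * expectation (\<lambda>\<omega>. Q d \<omega> * Q d \<omega>)
      + 2 * (\<alpha> d * \<beta> d) * expectation (\<lambda>\<omega>. Q d \<omega> * P d \<omega>))"
proof -
  let ?Y = "\<lambda>d \<omega>. \<alpha> d * P d \<omega> + \<beta> d * Q d \<omega>"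
  have int: "integrable M (\<lambda>\<omega>. P c \<omega> * P d \<omega>)" "integrable M (\<lambda>\<omega>. Q c \<omega> * Q d \<omega>)"
    "integrable M (\<lambda>\<omega>. Q c \<omega> * P d \<omega>)" if "c \<in> N" "d \<in> N" for c d
    using that meas sq by (auto intro!: integrable_mult_of_squares)
  have expand: "?Y c \<omega> * ?Y d \<omega> = \<alpha> c * \<alpha> d * (P c \<omega> * P d \<omega>) + \<beta> c * \<beta> d * (Q c \<omega> * Q d \<omega>)
      + \<beta> c * \<alpha> d * (Q c \<omega> * P d \<omega>) + \<alpha> c * \<beta> d * (Q d \<omega> * P c \<omega>)" for c d \<omega>
    by (simp add: algebra_simps)
  have intY: "integrable M (\<lambda>\<omega>. ?Y c \<omega> * ?Y d \<omega>)" if "c \<in> N" "d \<in> N" for c d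
    unfolding expand using int that by simp
  have expY: "expectation (\<lambda>\<omega>. ?Y c \<omega> * ?Y d \<omega>) =
      \<alpha> c * \<alpha> d * expectation (\<lambda>\<omega>. P c \<omega> * P d \<omega>) + \<beta> c * \<beta> d * expectation (\<lambda>\<omega>. Q c \<omega> * Q d \<omega>)
      + \<beta> c * \<alpha> d * expectation (\<lambda>\<omega>. Q c \<omega> * P d \<omega>) + \<alpha> c * \<beta> d * expectation (\<lambda>\<omega>. Q d \<omega> * P c \<omega>)"
    if "c \<in> N" "d \<in> N" for c d
    unfolding expand using int that by simp
  have "expectation (\<lambda>\<omega>. (\<Sum>d\<in>N. ?Y d \<omega>)\<^sup>2) = (\<Sum>c\<in>N. \<Sum>d\<in>N. expectation (\<lambda>\<omega>. ?Y c \<omega> * ?Y d \<omega>))"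
    unfolding power2_eq_square sum_product
    using intY by (subst Bochner_Integration.integral_sum; simp)
  also have "\<dots> = (\<Sum>c\<in>N. \<Sum>d\<in>N. if d = c then expectation (\<lambda>\<omega>. ?Y c \<omega> * ?Y c \<omega>) else 0)"
  proof (intro sum.cong refl)
    fix c d assume "c \<in> N" "d \<in> N"
    then show "expectation (\<lambda>\<omega>. ?Y c \<omega> * ?Y d \<omega>) = (if d = c then expectation (\<lambda>\<omega>. ?Y c \<omega> * ?Y c \<omega>) else 0)"
      using expY[of c d] unc[of c d] unc(3)[of d c] by (cases "d = c") auto
  qed
  also have "\<dots> = (\<Sum>c\<in>N. expectation (\<lambda>\<omega>. ?Y c \<omega> * ?Y c \<omega>))"
    using fin by simp
  also have "\<dots> = (\<Sum>d\<in>N. (\<alpha> d)\<^sup>2 * expectation (\<lambda>\<omega>. P d \<omega> * P d \<omega>)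
      + (\<beta> d)\<^sup>2 * expectation (\<lambda>\<omega>. Q d \<omega> * Q d \<omega>)
      + 2 * (\<alpha> d * \<beta> d) * expectation (\<lambda>\<omega>. Q d \<omega> * P d \<omega>))"
    by (rule sum.cong[OF refl], subst expY) (simp_all add: power2_eq_square)
  finally show ?thesis .
qed

text \<open>Centring removes the offset \<open>k\<close>, which is present so that a constant
  voltage also fits the affine form.\<close>

lemma (in prob_space) phi_affine_uncorrelated:
  fixes p q :: "'v \<Rightarrow> 'a \<Rightarrow> real"
  assumes fin: "finite N"
    and meas: "\<forall>d\<in>N. p d \<in> borel_measurable M" "\<forall>d\<in>N. q d \<in> borel_measurable M"
    and sq: "\<forall>d\<in>N. integrable M (\<lambda>\<omega>. (p d \<omega>)\<^sup>2)" "\<forall>d\<in>N. integrable M (\<lambda>\<omega>. (q d \<omega>)\<^sup>2)"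
    and unc: "\<forall>c\<in>N. \<forall>d\<in>N. c \<noteq> d \<longrightarrow> covar M (p c) (p d) = 0"
      "\<forall>c\<in>N. \<forall>d\<in>N. c \<noteq> d \<longrightarrow> covar M (q c) (q d) = 0"
      "\<forall>c\<in>N. \<forall>d\<in>N. c \<noteq> d \<longrightarrow> covar M (q c) (p d) = 0"
    and v: "v u = (\<lambda>\<omega>. k u + (\<Sum>d\<in>N. A u d * p d \<omega>) + (\<Sum>d\<in>N. B u d * q d \<omega>))"
      "v w = (\<lambda>\<omega>. k w + (\<Sum>d\<in>N. A w d * p d \<omega>) + (\<Sum>d\<in>N. B w d * q d \<omega>))"
  shows "phi M v u w = (\<Sum>d\<in>N. (A u d - A w d)\<^sup>2 * covar M (p d) (p d)
     + (B u d - B w d)\<^sup>2 * covar M (q d) (q d)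
     + 2 * ((A u d - A w d) * (B u d - B w d)) * covar M (q d) (p d))"
proof -
  let ?P = "\<lambda>d \<omega>. p d \<omega> - expectation (p d)" and ?Q = "\<lambda>d \<omega>. q d \<omega> - expectation (q d)"
  have int: "integrable M (p d)" "integrable M (q d)" if "d \<in> N" for d
    using that meas sq square_integrable_imp_integrable by blast+
  have centred: "v y \<omega> - expectation (v y) = (\<Sum>d\<in>N. A y d * ?P d \<omega> + B y d * ?Q d \<omega>)"
    if "v y = (\<lambda>\<omega>. k y + (\<Sum>d\<in>N. A y d * p d \<omega>) + (\<Sum>d\<in>N. B y d * q d \<omega>))" for y \<omega>
  proof -
    have "expectation (v y) = k y + (\<Sum>d\<in>N. A y d * expectation (p d)) + (\<Sum>d\<in>N. B y d * expectation (q d))"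
      unfolding that using int
      by (simp add: Bochner_Integration.integral_add Bochner_Integration.integral_sum prob_space)
    then show ?thesis
      unfolding that by (simp add: sum.distrib sum_subtractf right_diff_distrib)
  qed
  have "phi M v u w =
      expectation (\<lambda>\<omega>. (\<Sum>d\<in>N. (A u d - A w d) * ?P d \<omega> + (B u d - B w d) * ?Q d \<omega>)\<^sup>2)"
    unfolding phi_def centred[OF v(1)] centred[OF v(2)] sum_subtractf[symmetric]
    by (simp add: algebra_simps)
  also have "\<dots> = (\<Sum>d\<in>N. (A u d - A w d)\<^sup>2 * covar M (p d) (p d)
     + (B u d - B w d)\<^sup>2 * covar M (q d) (q d)
     + 2 * ((A u d - A w d) * (B u d - B w d)) * covar M (q d) (p d))"
    unfolding covar_def
  proof (rule integral_square_sum_uncorrelated[OF fin])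
    fix d assume d: "d \<in> N"
    show "?P d \<in> borel_measurable M" "?Q d \<in> borel_measurable M" using meas d by auto
    show "integrable M (\<lambda>\<omega>. (?P d \<omega>)\<^sup>2)" "integrable M (\<lambda>\<omega>. (?Q d \<omega>)\<^sup>2)"
      using int[OF d] sq d by (simp_all add: power2_diff)
  qed (use unc in \<open>auto simp: covar_def\<close>)
  finally show ?thesis .
qed

section \<open>Spanning trees of the observed nodes\<close>

theorem theorem5:
  fixes V :: "'v set" and E :: "'v set set" and rt :: 'v
    and r x :: "'v set \<Rightarrow> real"
    and M :: "'m measure"
    and p q :: "'v \<Rightarrow> 'm \<Rightarrow> real"
    and Rinv Xinv :: "'v \<Rightarrow> 'v \<Rightarrow> real"
    and v :: "'v \<Rightarrow> 'm \<Rightarrow> real" and v0 :: real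
    and Mis :: "'v set" and TM :: "'v set set"
    and a b cstar :: 'v
  assumes tree: "is_tree V E"
    and root_in: "rt \<in> V"
    and root_deg: "degree E rt = 1"
    and r_pos: "\<forall>e\<in>E. r e > 0"
    and x_pos: "\<forall>e\<in>E. x e > 0"
    and Rinv: "is_inverse_on (V - {rt}) (laplacian E (\<lambda>e. 1 / r e)) Rinv"
    and Xinv: "is_inverse_on (V - {rt}) (laplacian E (\<lambda>e. 1 / x e)) Xinv"
    and prob: "prob_space M"
    and p_meas: "\<forall>c\<in>V - {rt}. p c \<in> borel_measurable M"
    and q_meas: "\<forall>c\<in>V - {rt}. q c \<in> borel_measurable M"
    and p_sq: "\<forall>c\<in>V - {rt}. integrable M (\<lambda>\<omega>. (p c \<omega>)\<^sup>2)"
    and q_sq: "\<forall>c\<in>V - {rt}. integrable M (\<lambda>\<omega>. (q c \<omega>)\<^sup>2)"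
    and v_def: "\<forall>c\<in>V - {rt}. v c =
                  (\<lambda>\<omega>. (\<Sum>d\<in>V - {rt}. Rinv c d * p d \<omega>) + (\<Sum>d\<in>V - {rt}. Xinv c d * q d \<omega>))"
    and v_root: "v rt = (\<lambda>\<omega>. v0)"
    and cov_p: "\<forall>c\<in>V - {rt}. \<forall>d\<in>V - {rt}. c \<noteq> d \<longrightarrow> covar M (p c) (p d) = 0"
    and cov_q: "\<forall>c\<in>V - {rt}. \<forall>d\<in>V - {rt}. c \<noteq> d \<longrightarrow> covar M (q c) (q d) = 0"
    and cov_qp: "\<forall>c\<in>V - {rt}. \<forall>d\<in>V - {rt}. c \<noteq> d \<longrightarrow> covar M (q c) (p d) = 0"
    and cov_qp_diag: "\<forall>c\<in>V - {rt}. covar M (q c) (p c) \<ge> 0"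
    and var_pos: "\<forall>c\<in>V - {rt}. covar M (p c) (p c) + covar M (q c) (q c) > 0"
    and Mis_sub: "Mis \<subseteq> V - {rt}"
    and Mis_deg: "\<forall>m\<in>Mis. degree E m > 2"
    and Mis_far: "\<forall>m1\<in>Mis. \<forall>m2\<in>Mis. m1 \<noteq> m2 \<longrightarrow> hop_dist E m1 m2 > 2"
    and TM_MST: "is_MST (V - Mis) (phi M v) TM"
    and TM_unique: "\<forall>T. is_MST (V - Mis) (phi M v) T \<longrightarrow> T = TM"
    and b_mis: "b \<in> Mis"
    and a_parent: "parent_of E rt a b"
    and cstar_child: "cstar \<in> children E rt b"
    and cstar_min: "\<forall>c\<in>children E rt b. phi M v b cstar \<le> phi M v b c"
  shows "(\<forall>ci\<in>children E rt b - {cstar}. \<forall>cj\<in>children E rt b - {cstar}. {ci, cj} \<notin> TM)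
       \<and> (\<forall>ci\<in>children E rt b. phi M v a ci < phi M v cstar ci \<longrightarrow> {a, ci} \<in> TM)
       \<and> (\<forall>ci\<in>children E rt b - {cstar}. \<not> (phi M v a ci < phi M v cstar ci) \<longrightarrow> {cstar, ci} \<in> TM)"
proof -
  interpret T: rooted_tree V E rt using tree root_in by unfold_locales
  interpret prob_space M by (rule prob)
  let ?N = "V - {rt}" and ?C = "children E rt b" and ?W = "V - Mis"
  define \<Phi> where "\<Phi> = T.diff_form r x (\<lambda>d. covar M (p d) (p d)) (\<lambda>d. covar M (q d) (q d))
    (\<lambda>d. covar M (q d) (p d))"
  have nonneg: "0 \<le> covar M (p d) (p d) \<and> 0 \<le> covar M (q d) (q d) \<and> 0 \<le> covar M (q d) (p d)"
    if "d \<in> ?N" for d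
    using cov_qp_diag that by (auto simp: covar_def intro!: Bochner_Integration.integral_nonneg)

  \<comment> \<open>Zero rows at the root, with offset \<open>v0\<close>, give the root voltage the
    same affine form as the others.\<close>
  define A B k where "A u d = (if u = rt then 0 else Rinv u d)"
    and "B u d = (if u = rt then 0 else Xinv u d)" and "k u = (if u = rt then v0 else 0)" for u d
  have v: "v u = (\<lambda>\<omega>. k u + (\<Sum>d\<in>?N. A u d * p d \<omega>) + (\<Sum>d\<in>?N. B u d * q d \<omega>))"
    if "u \<in> V" for u
    using that v_root v_def by (cases "u = rt") (simp_all add: A_def B_def k_def)
  have phi_eq: "phi M v u w = \<Phi> u w" if uw: "u \<in> V" "w \<in> V" for u w
  proof -
    have "A u d - A w d = T.path_diff r u w d" "B u d - B w d = T.path_diff x u w d"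
      if "d \<in> ?N" for d
      unfolding A_def B_def
      using T.laplacian_inverse_diff[OF Rinv r_pos that uw] T.laplacian_inverse_diff[OF Xinv x_pos that uw]
      by auto
    moreover have "finite ?N" using T.fin_V by simp
    ultimately show ?thesis
      using phi_affine_uncorrelated[OF _ p_meas q_meas p_sq q_sq cov_p cov_q cov_qp v[OF uw(1)] v[OF uw(2)]]
      by (simp add: \<Phi>_def T.diff_form_def)
  qed

  have neighbour_observed: "y \<in> ?W" if "{b, y} \<in> E" for y
  proof -
    have y: "y \<in> V" "y \<noteq> b" using T.adj_in_V[OF that] by auto
    have "hop_dist E b y \<le> 1"
      unfolding hop_dist_def
      by (rule Least_le, rule exI[of _ "[b, y]"]) (use that in \<open>simp add: walk_iff\<close>)
    then show ?thesis using Mis_far b_mis y by force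
  qed
  have bV: "b \<in> V" using b_mis Mis_sub by auto
  have aW: "a \<in> ?W" using neighbour_observed[of a] a_parent by (simp add: T.parent_of_iff)
  have CW: "c \<in> ?W" if "c \<in> ?C" for c
    using neighbour_observed[of c] that by (simp add: T.child_iff insert_commute)
  have sym: "phi M v u w = phi M v w u" for u w
    unfolding phi_def by (simp add: power2_commute)
  have sibling: "phi M v c c' = phi M v b c + phi M v b c'"
    if "c \<in> ?C" "c' \<in> ?C" "c \<noteq> c'" for c c'
    using T.diff_form_siblings[OF that, of r x] phi_eq CW that bV by (simp add: \<Phi>_def)
  \<comment> \<open>By additivity both sides share the summand \<open>phi M v b c\<close>, so the
    choice of \<open>cstar\<close> decides.\<close>
  have to_cstar: "phi M v c cstar \<le> phi M v c c'" if "c \<in> ?C" "c \<noteq> cstar" "c' \<in> ?C" "c' \<noteq> c" for c c'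
    using sibling[of c cstar] sibling[of c c'] cstar_child cstar_min that by auto

  \<comment> \<open>Here \<open>y\<close> is whichever of \<open>a\<close> and \<open>cstar\<close>
    is cheaper for \<open>c\<close>; both halves of the second claim are instances.\<close>
  have cut: "{c, y} \<in> TM"
    if c: "c \<in> ?C" "c \<noteq> cstar" and y: "y = a \<or> y = cstar"
      and ya: "phi M v c y \<le> phi M v c a" and yc: "phi M v c y \<le> phi M v c cstar" for c y
  proof (rule unique_MST_cut_property[OF TM_MST TM_unique sym])
    let ?X = "T.branch {c, b} - Mis"
    have cb: "{c, b} \<in> E" "c \<in> T.branch {c, b}" using c by (auto simp: T.child_iff)
    show "?X \<subseteq> ?W" using T.branch_subset[OF cb(1)] by auto
    show "c \<in> ?X" using cb CW[OF c(1)] by auto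
    show "y \<in> ?W" using y aW CW[OF cstar_child] by auto
    have "a \<notin> T.branch {c, b}"
      using T.branch_child_subset[OF a_parent c(1)] a_parent T.branch_endpoints[of b a]
      by (auto simp: T.parent_of_iff)
    moreover have "cstar \<notin> T.branch {c, b}"
      using T.branch_siblings_disjoint[OF c(1) cstar_child c(2)] cstar_child by (auto simp: T.child_iff)
    ultimately show "y \<notin> ?X" using y by auto
    fix s t assume st: "s \<in> ?X" "t \<in> ?W" "t \<notin> ?X"
    have V: "s \<in> V" "t \<in> V" "c \<in> V" "a \<in> V"
      using st T.branch_subset[OF cb(1)] CW[OF c(1)] aW by auto
    \<comment> \<open>An observed \<open>t\<close> outside the observed part of the branch is
      outside the whole branch, and it is not the missing node \<open>b\<close>.\<close>
    have "t \<notin> T.branch {c, b}" "t \<noteq> b" using st b_mis by auto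
    then have "\<Phi> a c \<le> \<Phi> s t \<or> (\<exists>c'\<in>?C. c' \<noteq> c \<and> \<Phi> c c' \<le> \<Phi> s t)"
      unfolding \<Phi>_def
      using st by (intro T.diff_form_branch_exit[OF r_pos x_pos nonneg a_parent c(1)]) auto
    then consider "phi M v c a \<le> phi M v s t"
      | c' where "c' \<in> ?C" "c' \<noteq> c" "phi M v c c' \<le> phi M v s t"
      using V CW phi_eq sym[of c a] by auto
    then show "phi M v c y \<le> phi M v s t"
      using ya yc to_cstar[OF c] by cases (meson order_trans)+
  qed

  show ?thesis
  proof (intro conjI ballI impI)
    fix ci cj assume c: "ci \<in> ?C - {cstar}" "cj \<in> ?C - {cstar}"
    show "{ci, cj} \<notin> TM"
    \<comment> \<open>Equal indices give a singleton, which is no edge of the complete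
      graph.\<close>
    proof (cases "ci = cj")
      case True
      have "TM \<subseteq> complete_edges ?W"
        using TM_MST by (simp add: is_MST_def is_spanning_tree_of_complete_def)
      then show ?thesis using True by (auto simp: complete_edges_def doubleton_eq_iff)
    next
      case False
      then show ?thesis
        using c CW cstar_child to_cstar[of ci cj] to_cstar[of cj ci] sym[of cj ci]
        by (intro unique_MST_triangle_property[OF TM_MST TM_unique sym, of ci cj cstar]) auto
    qed
  next
    fix ci assume ci: "ci \<in> ?C" "phi M v a ci < phi M v cstar ci"
    \<comment> \<open>The child \<open>cstar\<close> fails the strict inequality, as its distance to
      itself is 0.\<close>
    have "0 \<le> phi M v a ci" unfolding phi_def by simp
    moreover have "phi M v cstar cstar = 0" unfolding phi_def by simp
    ultimately have "ci \<noteq> cstar" using ci by auto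
    then show "{a, ci} \<in> TM"
      using cut[of ci a] ci sym[of ci a] sym[of ci cstar] by (simp add: insert_commute)
  next
    fix ci assume ci: "ci \<in> ?C - {cstar}" "\<not> phi M v a ci < phi M v cstar ci"
    then show "{cstar, ci} \<in> TM"
      using cut[of ci cstar] sym[of ci a] sym[of ci cstar] by (simp add: insert_commute)
  qed
qed

end
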